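(* For every integer $n \ge 1$, $\mu_d(ST_3^n) = 3$ if $n = 1$, and $\mu_d(ST_3^n) = 4$ if $n \ge 2$.
   Context: Sierpiński triangle graphs are defined recursively: $ST_3^0 = K_3$, whose three vertices are its extreme vertices, called top, left and right. For $n \ge 0$, $ST_3^{n+1}$ is obtained from three disjoint copies $T, L, R$ of $ST_3^n$ by identifying the left extreme vertex of $T$ with the top extreme vertex of $L$, the right extreme vertex of $T$ with the top extreme vertex of $R$, and the right extreme vertex of $L$ with the left extreme vertex of $R$; the extreme vertices of $ST_3^{n+1}$ are the top vertex of $T$, the left vertex of $L$ and the right vertex of $R$. For a graph $G$ and $M \subseteq V(G)$, vertices $u,v$ are $M$-visible if some shortest $u,v$-path in $G$ contains no vertex of $M \setminus \{u,v\}$. $M$ is a dual mutual-visibility set of $G$ if every two vertices of $M$ are $M$-visible and every two vertices of $V(G) \setminus M$ are $M$-visible. $\mu_d(G)$ is the largest cardinality of a dual mutual-visibility set of $G$. *)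

theory Defs
  imports Graph_Theory.Graph_Theory
begin

datatype corner = TopC | LeftC | RightC

text \<open>
  The three disjoint copies of a graph on words over \<open>corner\<close> are obtained by prefixing the name
  of the copy to each vertex. If \<open>e\<close> gives the extreme vertices of that graph, \<open>identify e\<close> sends
  both members of each pair of vertices to be identified to one chosen member of the pair, and
  fixes every other vertex.
\<close>

definition identify :: "(corner \<Rightarrow> corner list) \<Rightarrow> corner list \<Rightarrow> corner list" where
  "identify e v =
     (if v = LeftC # e TopC then TopC # e LeftC
      else if v = RightC # e TopC then TopC # e RightC
      else if v = RightC # e LeftC then LeftC # e RightC
      else v)"

primrec extreme :: "nat \<Rightarrow> corner \<Rightarrow> corner list" where
  "extreme 0 c = [c]"
| "extreme (Suc n) c = identify (extreme n) (c # extreme n c)"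

primrec ST :: "nat \<Rightarrow> corner list pair_pre_digraph" where
  "ST 0 =
     \<lparr> pverts = range (extreme 0),
       parcs = {(u, v). u \<in> range (extreme 0) \<and> v \<in> range (extreme 0) \<and> u \<noteq> v} \<rparr>"
| "ST (Suc n) =
     (let copy = (\<lambda>c v. identify (extreme n) (c # v)) in
     \<lparr> pverts = {copy c v | c v. v \<in> pverts (ST n)},
       parcs = {(copy c u, copy c v) | c u v. (u, v) \<in> parcs (ST n)} \<rparr>)"

definition shortest_vpath :: "('a, 'b) pre_digraph \<Rightarrow> 'a \<Rightarrow> 'a vwalk \<Rightarrow> 'a \<Rightarrow> bool" where
  "shortest_vpath G u p v \<longleftrightarrow>
     vpath p G \<and> hd p = u \<and> last p = v \<and>
     (\<forall>q. vpath q G \<and> hd q = u \<and> last q = v \<longrightarrow> vwalk_length p \<le> vwalk_length q)"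

definition visible :: "('a, 'b) pre_digraph \<Rightarrow> 'a set \<Rightarrow> 'a \<Rightarrow> 'a \<Rightarrow> bool" where
  "visible G M u v \<longleftrightarrow> (\<exists>p. shortest_vpath G u p v \<and> set p \<inter> (M - {u, v}) = {})"

definition dual_mutual_visibility_set :: "('a, 'b) pre_digraph \<Rightarrow> 'a set \<Rightarrow> bool" where
  "dual_mutual_visibility_set G M \<longleftrightarrow>
     M \<subseteq> verts G \<and>
     (\<forall>u\<in>M. \<forall>v\<in>M. u \<noteq> v \<longrightarrow> visible G M u v) \<and>
     (\<forall>u\<in>verts G - M. \<forall>v\<in>verts G - M. u \<noteq> v \<longrightarrow> visible G M u v)"

text \<open>
  Only meaningful for finite \<open>G\<close>: the empty set is always a dual mutual-visibility set of a
  connected graph, so the maximum is then over a finite nonempty set.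
\<close>

definition mu_d :: "('a, 'b) pre_digraph \<Rightarrow> nat" where
  "mu_d G = Max (card ` {M. dual_mutual_visibility_set G M})"

lemma UNIV_corner: "(UNIV :: corner set) = {TopC, LeftC, RightC}"
proof -
  have "c \<in> {TopC, LeftC, RightC}" for c by (cases c) simp_all
  then show ?thesis by blast
qed

lemma extreme_eq: "extreme n c = replicate (Suc n) c"
proof (induction n arbitrary: c)
  case (Suc n)
  then show ?case by (cases c) (simp_all add: identify_def)
qed simp

lemma inj_extreme: "inj (extreme n)"
  by (auto simp: inj_def extreme_eq)

lemma identify_eq_iff:
  assumes "inj e"
  shows "identify e v = identify e w \<longleftrightarrow>
    v = w \<or>
    {v, w} = {TopC # e LeftC, LeftC # e TopC} \<or>
    {v, w} = {TopC # e RightC, RightC # e TopC} \<or>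
    {v, w} = {LeftC # e RightC, RightC # e LeftC}"
proof -
  have d: "e TopC \<noteq> e LeftC" "e TopC \<noteq> e RightC" "e LeftC \<noteq> e RightC"
    using assms by (simp_all add: inj_eq)
  let ?S = "{LeftC # e TopC, RightC # e TopC, RightC # e LeftC}"
  show ?thesis
  proof (cases "v \<in> ?S")
    case True
    then consider "v = LeftC # e TopC" | "v = RightC # e TopC" | "v = RightC # e LeftC"
      by auto
    then show ?thesis
      using d by cases (auto simp: identify_def doubleton_eq_iff)
  next
    case v: False
    show ?thesis
    proof (cases "w \<in> ?S")
      case True
      then consider "w = LeftC # e TopC" | "w = RightC # e TopC" | "w = RightC # e LeftC"
        by auto
      then show ?thesis
        using d v by cases (auto simp: identify_def doubleton_eq_iff)
    next
      case False
      with v show ?thesis by (simp add: identify_def doubleton_eq_iff)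
    qed
  qed
qed

lemma inj_copy: "inj (\<lambda>v. identify (extreme n) (c # v))"
  by (auto simp: inj_def identify_eq_iff[OF inj_extreme] doubleton_eq_iff)

lemma complete_ST_0: "K\<^bsub>3\<^esub> (with_proj (ST 0))"
  by (auto simp: complete_digraph_pair_def UNIV_corner)

lemma pverts_ST_Suc:
  "pverts (ST (Suc n)) = {identify (extreme n) (c # v) | c v. v \<in> pverts (ST n)}"
  by (simp add: Let_def)

lemma parcs_ST_Suc:
  "parcs (ST (Suc n)) =
     {(identify (extreme n) (c # u), identify (extreme n) (c # v)) | c u v. (u, v) \<in> parcs (ST n)}"
  by (simp add: Let_def)

lemma extreme_in_ST: "extreme n c \<in> pverts (ST n)"
proof (induction n)
  case (Suc n)
  then show ?case unfolding pverts_ST_Suc extreme.simps by blast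
qed simp

lemma pair_graph_ST: "pair_graph (ST n)"
proof (induction n)
  case 0
  show ?case by (rule pair_graphI_complete[OF complete_ST_0])
next
  case (Suc n)
  then interpret G: pair_graph "ST n" .
  have fin: "finite (UNIV :: corner set)" by (simp add: UNIV_corner)
  have V: "pverts (ST (Suc n)) = (\<Union>c. (\<lambda>v. identify (extreme n) (c # v)) ` pverts (ST n))"
    unfolding pverts_ST_Suc by blast
  have finV: "finite (pverts (ST (Suc n)))"
    unfolding V by (intro finite_UN_I finite_imageI fin G.pair_finite_verts)
  have arc: "fst e \<in> pverts (ST (Suc n)) \<and> snd e \<in> pverts (ST (Suc n)) \<and> fst e \<noteq> snd e"
    if "e \<in> parcs (ST (Suc n))" for e
  proof -
    from that obtain c a b where ab: "(a, b) \<in> parcs (ST n)"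
      and e: "e = (identify (extreme n) (c # a), identify (extreme n) (c # b))"
      unfolding parcs_ST_Suc mem_Collect_eq by (elim exE conjE)
    have "a \<in> pverts (ST n)" "b \<in> pverts (ST n)"
      using G.in_arcsD1[OF ab] G.in_arcsD2[OF ab] .
    then have "fst e \<in> pverts (ST (Suc n))" "snd e \<in> pverts (ST (Suc n))"
      unfolding pverts_ST_Suc e fst_conv snd_conv by blast+
    moreover have "a \<noteq> b" using G.pair_no_loops[OF ab] by simp
    then have "fst e \<noteq> snd e"
      unfolding e fst_conv snd_conv using injD[OF inj_copy[of n c], of a b] by blast
    ultimately show ?thesis by (intro conjI)
  qed
  have "parcs (ST (Suc n)) \<subseteq> pverts (ST (Suc n)) \<times> pverts (ST (Suc n))"
    using arc by (intro subsetI) (simp only: mem_Times_iff)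
  then have finA: "finite (parcs (ST (Suc n)))"
    using finV finite_subset by blast
  have "sym (parcs (ST (Suc n)))"
  proof (rule symI)
    fix u v assume "(u, v) \<in> parcs (ST (Suc n))"
    then obtain c a b where ab: "(a, b) \<in> parcs (ST n)"
      and uv: "(u, v) = (identify (extreme n) (c # a), identify (extreme n) (c # b))"
      unfolding parcs_ST_Suc mem_Collect_eq by (elim exE conjE)
    have "(b, a) \<in> parcs (ST n)" using ab by (rule G.arcs_symmetric)
    then show "(v, u) \<in> parcs (ST (Suc n))"
      using uv unfolding parcs_ST_Suc mem_Collect_eq by (intro exI[of _ c] exI[of _ b] exI[of _ a]) simp
  qed
  then have "symmetric (with_proj (ST (Suc n)))"
    by (simp add: symmetric_def del: ST.simps)
  with finV finA arc show ?case
    by unfold_locales (simp_all del: ST.simps)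
qed

end

theory Submission
  imports Defs
begin

text \<open>
  In barycentric coordinates \<open>ST (Suc n)\<close> is a union of copies of the 6-vertex graph of level 1,
  glued at their corners. Let \<open>M\<close> be a dual mutual-visibility set. A corner \<open>w\<close> shared by two copies
  is not in \<open>M\<close>: comparing the midpoints next to \<open>w\<close> across \<open>w\<close>, exactly one of the two copies has
  both of them in \<open>M\<close>. The remaining midpoint \<open>r\<close> of that copy is then in \<open>M\<close>, as otherwise \<open>w\<close>
  separates it from the midpoints of the other copy that are next to \<open>w\<close>; but now \<open>r\<close> and \<open>w\<close> do not
  see each other. A midpoint in \<open>M\<close> is the only common neighbour of the two corners it lies between, so
  one of these is in \<open>M\<close> and hence an extreme vertex. Thus \<open>M\<close> consists of extreme vertices and some
  of their neighbours. If the extreme vertices \<open>a\<close> and \<open>b\<close> are in \<open>M\<close>, the neighbour of \<open>a\<close> towards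
  \<open>b\<close> is not, because the side is the only shortest path between them. With \<open>s\<close> extreme vertices in
  \<open>M\<close> this leaves at most \<open>s * (1 + (3 - s)) \<le> 4\<close> vertices, and on level 1 the case \<open>s = 2\<close> allows
  only 3. The bounds are attained by two extreme vertices together with their neighbours towards the
  third and, on level 1, by the three extreme vertices.
\<close>

section \<open>Shortest paths and visibility\<close>

text \<open>Repeated vertices are allowed so that walks can be spliced, cut and reversed freely; a
  walk of minimal length is a path anyway.\<close>

definition walk :: "('a, 'b) pre_digraph \<Rightarrow> 'a \<Rightarrow> 'a list \<Rightarrow> 'a \<Rightarrow> bool" where
  "walk G u p v \<longleftrightarrow> vwalk p G \<and> hd p = u \<and> last p = v"

lemma vwalk_arcs_subset_iff:
  "set (vwalk_arcs p) \<subseteq> A \<longleftrightarrow> successively (\<lambda>x y. (x, y) \<in> A) p"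
  by (induction p rule: vwalk_arcs.induct) auto

lemma vwalk_iff:
  "vwalk p G \<longleftrightarrow> p \<noteq> [] \<and> set p \<subseteq> verts G \<and> successively (\<lambda>x y. (x, y) \<in> arcs_ends G) p"
  by (auto simp: vwalk_def vwalk_arcs_subset_iff)

lemma walk_iff:
  "walk G u p v \<longleftrightarrow> p \<noteq> [] \<and> set p \<subseteq> verts G \<and>
     successively (\<lambda>x y. (x, y) \<in> arcs_ends G) p \<and> hd p = u \<and> last p = v"
  by (auto simp: walk_def vwalk_iff)

lemma shortest_walk_distinct:
  assumes p: "walk G u p v" and min: "\<And>q. walk G u q v \<Longrightarrow> length p \<le> length q"
  shows "distinct p"
proof (rule ccontr)
  assume "\<not> distinct p"
  then obtain xs ys zs y where eq: "p = xs @ [y] @ ys @ [y] @ zs"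
    using not_distinct_decomp by blast
  have "walk G u (xs @ [y] @ zs) v"
    using p unfolding eq walk_iff
    by (cases xs; cases zs) (auto simp: successively_append_iff successively_Cons hd_append split: if_splits)
  from min[OF this] show False by (simp add: eq)
qed

text \<open>A walk of minimal length has no repeated vertex, so minimality among paths and among
  walks agree. Later minimality arguments can therefore compare with arbitrary walks.\<close>

lemma shortest_vpath_iff:
  "shortest_vpath G u p v \<longleftrightarrow>
     walk G u p v \<and> (\<forall>q. walk G u q v \<longrightarrow> length p \<le> length q)"
  (is "?L \<longleftrightarrow> ?R")
proof
  assume R: ?R
  then have "distinct p" using shortest_walk_distinct by metis
  with R show ?L
    by (auto simp: shortest_vpath_def vpath_def walk_def intro: diff_le_mono)
next
  assume L: ?L
  then have p: "walk G u p v" by (auto simp: shortest_vpath_def vpath_def walk_def)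
  define p0 where "p0 = arg_min length (\<lambda>q. walk G u q v)"
  have p0: "walk G u p0 v"
    unfolding p0_def by (rule arg_min_natI) (rule p)
  have min: "length p0 \<le> length q" if "walk G u q v" for q
    unfolding p0_def using that by (rule arg_min_nat_le)
  have "vpath p0 G"
    using p0 shortest_walk_distinct[OF p0 min] by (auto simp: vpath_def walk_def)
  \<comment> \<open>\<open>vwalk_length\<close> is the truncated difference
    \<open>length p - 1\<close>, so the comparison of lengths also uses that \<open>p0\<close> is
    nonempty.\<close>
  then have "length p - 1 \<le> length p0 - 1"
    using L p0 by (auto simp: shortest_vpath_def walk_def)
  moreover have "p0 \<noteq> []" using p0 by (simp add: walk_iff)
  ultimately have "length p \<le> length p0"
    by (cases p0) auto
  with p min show ?R using le_trans by blast
qed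

lemma shortest_vpath_exists:
  assumes "walk G u q v"
  obtains p where "shortest_vpath G u p v"
proof
  show "shortest_vpath G u (arg_min length (\<lambda>q. walk G u q v)) v"
    unfolding shortest_vpath_iff
    using arg_min_natI[of "\<lambda>q. walk G u q v", OF assms]
      arg_min_nat_le[of "\<lambda>q. walk G u q v"] by blast
qed

lemma visibleD:
  assumes "visible G M u v" "walk G u q v"
  obtains p where "walk G u p v" "length p \<le> length q" "set p \<inter> (M - {u, v}) = {}"
  using assms unfolding visible_def shortest_vpath_iff by blast

lemma visibleI:
  assumes "walk G u p v" "\<And>q. walk G u q v \<Longrightarrow> length p \<le> length q"
    and "set p \<inter> (M - {u, v}) = {}"
  shows "visible G M u v"
  using assms unfolding visible_def shortest_vpath_iff by blast

lemma walk_rev: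
  assumes "sym (arcs_ends G)" "walk G u p v"
  shows "walk G v (rev p) u"
proof -
  have "successively (\<lambda>x y. (y, x) \<in> arcs_ends G) p"
    using assms by (auto simp: walk_iff elim!: successively_mono dest: symD)
  with assms(2) show ?thesis by (auto simp: walk_iff hd_rev last_rev)
qed

lemma visible_sym:
  assumes "sym (arcs_ends G)" "visible G M u v"
  shows "visible G M v u"
proof -
  obtain p where p: "walk G u p v" "\<And>q. walk G u q v \<Longrightarrow> length p \<le> length q"
    and M: "set p \<inter> (M - {u, v}) = {}"
    using assms(2) unfolding visible_def shortest_vpath_iff by blast
  show ?thesis
  proof (rule visibleI)
    show "walk G v (rev p) u" using walk_rev[OF assms(1) p(1)] .
    show "length (rev p) \<le> length q" if "walk G v q u" for q
      using p(2)[OF walk_rev[OF assms(1) that]] by simp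
    show "set (rev p) \<inter> (M - {v, u}) = {}" using M by auto
  qed
qed

lemma visible_arc:
  assumes "(u, v) \<in> arcs_ends G" "u \<in> verts G" "v \<in> verts G" "u \<noteq> v"
  shows "visible G M u v"
proof (rule visibleI[of _ _ "[u, v]"])
  show "length [u, v] \<le> length q" if "walk G u q v" for q
    using that assms(4) by (cases q rule: vwalk_arcs.cases) (auto simp: walk_iff)
qed (use assms in \<open>auto simp: walk_iff\<close>)

text \<open>The two vertices have distance two, so the shortest path that makes them visible has
  exactly one inner vertex.\<close>

lemma visible_common_neighbour:
  assumes vis: "visible G M u v" and "u \<noteq> v" "(u, v) \<notin> arcs_ends G"
    and w: "(u, w) \<in> arcs_ends G" "(w, v) \<in> arcs_ends G" "{u, v, w} \<subseteq> verts G"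
  obtains x where "(u, x) \<in> arcs_ends G" "(x, v) \<in> arcs_ends G" "x \<notin> M - {u, v}"
proof -
  have "walk G u [u, w, v] v" using w by (auto simp: walk_iff)
  then obtain p where "walk G u p v" "length p \<le> length [u, w, v]" "set p \<inter> (M - {u, v}) = {}"
    by (rule visibleD[OF vis])
  then show thesis
    using assms(2,3) that
    by (cases p rule: vwalk_arcs.cases; cases "tl (tl p)"; cases "tl (tl (tl p))")
      (auto simp: walk_iff)
qed

text \<open>A shortest path neither turns back at \<open>z\<close> nor passes through
  \<open>z\<close> when a direct edge from \<open>x\<close> to \<open>y\<close> is
  available.\<close>

lemma shortest_vpath_interior:
  assumes p: "shortest_vpath G u p v" and z: "z \<in> set p" "z \<noteq> u" "z \<noteq> v"
  obtains xs x y ys where "p = xs @ [x, z, y] @ ys" "(x, z) \<in> arcs_ends G"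
    "(z, y) \<in> arcs_ends G" "x \<noteq> y" "(x, y) \<notin> arcs_ends G"
proof -
  have w: "walk G u p v" and min: "\<And>q. walk G u q v \<Longrightarrow> length p \<le> length q"
    using p by (auto simp: shortest_vpath_iff)
  obtain as bs where ab: "p = as @ z # bs" using z(1) by (meson split_list)
  have "as \<noteq> []" "bs \<noteq> []" using w z(2,3) ab by (auto simp: walk_iff)
  then obtain xs x y ys where "as = xs @ [x]" "bs = y # ys"
    by (metis neq_Nil_conv rev_exhaust)
  with ab have eq: "p = xs @ [x, z, y] @ ys" by simp
  have arcs: "(x, z) \<in> arcs_ends G" "(z, y) \<in> arcs_ends G"
    using w by (auto simp: eq walk_iff successively_append_iff)
  have "(x, y) \<notin> arcs_ends G"
  proof
    assume "(x, y) \<in> arcs_ends G"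
    then have "walk G u (xs @ [x, y] @ ys) v"
      using w unfolding eq walk_iff
      by (cases xs; cases ys) (auto simp: successively_append_iff successively_Cons hd_append split: if_splits)
    from min[OF this] show False by (simp add: eq)
  qed
  moreover have "x \<noteq> y"
    using p by (auto simp: eq shortest_vpath_def vpath_def)
  ultimately show thesis using that[OF eq arcs] by blast
qed

text \<open>Exchanging one inner vertex keeps the length, so the path stays shortest. By
  \<open>shortest_vpath_interior\<close> the new vertex \<open>r\<close> only has to serve distinct
  non-adjacent neighbours of \<open>z\<close>.\<close>

lemma shortest_vpath_replace:
  assumes p: "shortest_vpath G u p v" and z: "z \<noteq> u" "z \<noteq> v" and r: "r \<in> verts G"
    and swap: "\<And>x y. x \<in> set p \<Longrightarrow> y \<in> set p \<Longrightarrow> (x, z) \<in> arcs_ends G \<Longrightarrow> (z, y) \<in> arcs_ends G \<Longrightarrow>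
      x \<noteq> y \<Longrightarrow> (x, y) \<notin> arcs_ends G \<Longrightarrow> (x, r) \<in> arcs_ends G \<and> (r, y) \<in> arcs_ends G"
  obtains p' where "shortest_vpath G u p' v" "set p' \<subseteq> insert r (set p - {z})"
proof (cases "z \<in> set p")
  case False
  with p that[of p] show ?thesis by auto
next
  case True
  from shortest_vpath_interior[OF p True z] obtain xs x y ys
    where eq: "p = xs @ [x, z, y] @ ys" and arcs: "(x, z) \<in> arcs_ends G" "(z, y) \<in> arcs_ends G"
      and xy: "x \<noteq> y" "(x, y) \<notin> arcs_ends G" by metis
  have new: "(x, r) \<in> arcs_ends G" "(r, y) \<in> arcs_ends G"
    using swap[OF _ _ arcs xy] by (auto simp: eq)
  have w: "walk G u p v" and min: "\<And>q. walk G u q v \<Longrightarrow> length p \<le> length q"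
    using p by (auto simp: shortest_vpath_iff)
  have "walk G u (xs @ [x, r, y] @ ys) v"
    using w new r unfolding eq walk_iff
    by (cases xs; cases ys) (auto simp: successively_append_iff successively_Cons hd_append split: if_splits)
  then have "shortest_vpath G u (xs @ [x, r, y] @ ys) v"
    using min by (auto simp: shortest_vpath_iff eq)
  moreover have "distinct p" using p by (auto simp: shortest_vpath_def vpath_def)
  then have "set (xs @ [x, r, y] @ ys) \<subseteq> insert r (set p - {z})" by (auto simp: eq)
  ultimately show ?thesis using that by blast
qed

section \<open>Invariance of \<open>mu_d\<close> under isomorphism\<close>

locale digraph_iso =
  fixes G :: "'a pair_pre_digraph" and H :: "'b pair_pre_digraph" and f :: "'a \<Rightarrow> 'b"
  assumes inj: "inj_on f (pverts G)"
    and verts_H: "pverts H = f ` pverts G"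
    and arcs_H: "parcs H = map_prod f f ` parcs G"
    and arcs_G: "parcs G \<subseteq> pverts G \<times> pverts G"
begin

lemma arc_iff:
  "u \<in> pverts G \<Longrightarrow> v \<in> pverts G \<Longrightarrow> (f u, f v) \<in> parcs H \<longleftrightarrow> (u, v) \<in> parcs G"
  using arcs_G by (auto simp: arcs_H map_prod_def dest!: inj_onD[OF inj])

lemma walk_map:
  assumes "set p \<subseteq> pverts G" "u \<in> pverts G" "v \<in> pverts G"
  shows "walk (with_proj H) (f u) (map f p) (f v) \<longleftrightarrow> walk (with_proj G) u p v"
proof -
  have "successively (\<lambda>x y. (f x, f y) \<in> parcs H) p \<longleftrightarrow> successively (\<lambda>x y. (x, y) \<in> parcs G) p"
    using assms(1) by (intro successively_cong refl) (auto simp: arc_iff subset_iff)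
  moreover have "f (hd p) = f u \<longleftrightarrow> hd p = u" "f (last p) = f v \<longleftrightarrow> last p = v" if "p \<noteq> []"
    using assms that by (metis hd_in_set last_in_set inj inj_on_eq_iff subsetD)+
  ultimately show ?thesis
    using assms(1) by (auto simp: walk_iff successively_map hd_map last_map verts_H)
qed

lemma walk_lift:
  assumes "walk (with_proj H) (f u) q (f v)"
  obtains p where "set p \<subseteq> pverts G" "q = map f p"
proof -
  have "q \<in> lists (f ` pverts G)" using assms by (auto simp: walk_iff verts_H)
  then show thesis using that by (auto simp: lists_image)
qed

lemma shortest_vpath_map:
  assumes "set p \<subseteq> pverts G" "u \<in> pverts G" "v \<in> pverts G"
  shows "shortest_vpath (with_proj H) (f u) (map f p) (f v) \<longleftrightarrow> shortest_vpath (with_proj G) u p v"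
    (is "?L \<longleftrightarrow> ?R")
proof
  assume ?L
  moreover have "length p \<le> length q" if q: "walk (with_proj G) u q v" for q
  proof -
    have "walk (with_proj H) (f u) (map f q) (f v)"
      using q assms(2,3) by (subst walk_map) (auto simp: walk_iff)
    with \<open>?L\<close> show ?thesis by (force simp: shortest_vpath_iff)
  qed
  ultimately show ?R using assms by (auto simp: shortest_vpath_iff walk_map)
next
  assume R: ?R
  have "length p \<le> length q" if q: "walk (with_proj H) (f u) q (f v)" for q
  proof -
    obtain q' where "set q' \<subseteq> pverts G" "q = map f q'" using walk_lift[OF q] .
    with q R assms show ?thesis by (auto simp: shortest_vpath_iff walk_map)
  qed
  with R assms show ?L by (auto simp: shortest_vpath_iff walk_map)
qed

lemma visible_image:
  assumes "M \<subseteq> pverts G" "u \<in> pverts G" "v \<in> pverts G"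
  shows "visible (with_proj H) (f ` M) (f u) (f v) \<longleftrightarrow> visible (with_proj G) M u v"
proof -
  have int: "set (map f p) \<inter> (f ` M - {f u, f v}) = {} \<longleftrightarrow> set p \<inter> (M - {u, v}) = {}"
    if "set p \<subseteq> pverts G" for p
  proof -
    have "f x \<in> f ` M \<longleftrightarrow> x \<in> M" "f x = f u \<longleftrightarrow> x = u" "f x = f v \<longleftrightarrow> x = v" if "x \<in> set p" for x
      using that \<open>set p \<subseteq> pverts G\<close> assms inj
      by (auto simp: inj_on_image_mem_iff inj_on_eq_iff subset_iff)
    then have "(\<forall>x\<in>set p. f x \<notin> f ` M - {f u, f v}) \<longleftrightarrow> (\<forall>x\<in>set p. x \<notin> M - {u, v})"
      by simp
    then show ?thesis by auto
  qed
  show ?thesis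
  proof
    assume "visible (with_proj H) (f ` M) (f u) (f v)"
    then obtain q where q: "shortest_vpath (with_proj H) (f u) q (f v)"
      "set q \<inter> (f ` M - {f u, f v}) = {}" unfolding visible_def by blast
    have "walk (with_proj H) (f u) q (f v)" using q(1) by (simp add: shortest_vpath_iff)
    then obtain p where p: "set p \<subseteq> pverts G" "q = map f p" by (rule walk_lift)
    then have "shortest_vpath (with_proj G) u p v" "set p \<inter> (M - {u, v}) = {}"
      using q shortest_vpath_map[OF p(1) assms(2,3)] int[OF p(1)] by simp_all
    then show "visible (with_proj G) M u v" unfolding visible_def by blast
  next
    assume "visible (with_proj G) M u v"
    then obtain p where p: "shortest_vpath (with_proj G) u p v" "set p \<inter> (M - {u, v}) = {}"
      unfolding visible_def by blast
    from p(1) have sub: "set p \<subseteq> pverts G" by (auto simp: shortest_vpath_iff walk_iff)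
    have "shortest_vpath (with_proj H) (f u) (map f p) (f v)"
      "set (map f p) \<inter> (f ` M - {f u, f v}) = {}"
      using p shortest_vpath_map[OF sub assms(2,3)] int[OF sub] by blast+
    then show "visible (with_proj H) (f ` M) (f u) (f v)" unfolding visible_def by blast
  qed
qed

lemma dual_mutual_visibility_set_image:
  assumes "M \<subseteq> pverts G"
  shows "dual_mutual_visibility_set (with_proj H) (f ` M) \<longleftrightarrow>
    dual_mutual_visibility_set (with_proj G) M"
proof -
  have V: "pverts H - f ` M = f ` (pverts G - M)"
    using assms inj by (auto simp: verts_H inj_on_image_set_diff)
  have "(\<forall>u\<in>f ` A. \<forall>v\<in>f ` A. u \<noteq> v \<longrightarrow> visible (with_proj H) (f ` M) u v) \<longleftrightarrow>
      (\<forall>u\<in>A. \<forall>v\<in>A. u \<noteq> v \<longrightarrow> visible (with_proj G) M u v)" if "A \<subseteq> pverts G" for A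
  proof -
    have "f u = f v \<longleftrightarrow> u = v" "visible (with_proj H) (f ` M) (f u) (f v) \<longleftrightarrow> visible (with_proj G) M u v"
      if "u \<in> A" "v \<in> A" for u v
      using that \<open>A \<subseteq> pverts G\<close> visible_image[OF assms] inj_on_eq_iff[OF inj] by blast+
    then show ?thesis by simp
  qed
  from this[OF assms] this[OF Diff_subset] assms show ?thesis
    unfolding dual_mutual_visibility_set_def with_proj_simps V
    by (simp add: verts_H image_mono)
qed

lemma mu_d_eq: "mu_d (with_proj G) = mu_d (with_proj H)"
proof -
  have sub: "M \<subseteq> pverts G" if "dual_mutual_visibility_set (with_proj G) M" for M
    using that by (simp add: dual_mutual_visibility_set_def)
  have "{M. dual_mutual_visibility_set (with_proj H) M} =
      (`) f ` {M. dual_mutual_visibility_set (with_proj G) M}" (is "?L = ?R")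
  proof
    show "?R \<subseteq> ?L"
      using dual_mutual_visibility_set_image sub by blast
    show "?L \<subseteq> ?R"
    proof
      fix N assume N: "N \<in> ?L"
      then have "N \<subseteq> f ` pverts G"
        by (simp add: dual_mutual_visibility_set_def verts_H)
      then obtain M where "M \<subseteq> pverts G" "N = f ` M" by (auto simp: subset_image_iff)
      with N show "N \<in> ?R" using dual_mutual_visibility_set_image by blast
    qed
  qed
  then have "card ` {M. dual_mutual_visibility_set (with_proj H) M} =
      (\<lambda>M. card (f ` M)) ` {M. dual_mutual_visibility_set (with_proj G) M}"
    by (simp add: image_image)
  also have "\<dots> = card ` {M. dual_mutual_visibility_set (with_proj G) M}"
    using sub by (intro image_cong refl card_image inj_on_subset[OF inj]) simp
  finally show ?thesis by (simp add: mu_d_def)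
qed

end

section \<open>Barycentric coordinates\<close>

definition delta :: "corner \<Rightarrow> corner \<Rightarrow> nat" where
  "delta c k = (if k = c then 1 else 0)"

text \<open>
  Barycentric coordinates scaled so that edges have length 1. The elementary upward triangle with
  vertices \<open>t + delta i\<close> is represented by \<open>t\<close>; refining a triangulation doubles coordinates.
\<close>

primrec tri :: "nat \<Rightarrow> (corner \<Rightarrow> nat) set" where
  "tri 0 = {\<lambda>_. 0}"
| "tri (Suc n) = (\<Union>c. (\<lambda>t k. 2 * t k + delta c k) ` tri n)"

definition gasket :: "nat \<Rightarrow> (corner \<Rightarrow> nat) pair_pre_digraph" where
  "gasket n =
     \<lparr> pverts = (\<Union>i. (\<lambda>t k. t k + delta i k) ` tri n),
       parcs = (\<Union>i. \<Union>j\<in>-{i}. (\<lambda>t. (\<lambda>k. t k + delta i k, \<lambda>k. t k + delta j k)) ` tri n) \<rparr>"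

lemma all_corner: "(\<forall>c. P c) \<longleftrightarrow> P TopC \<and> P LeftC \<and> P RightC"
  by (metis corner.exhaust)

lemma point_eq_iff:
  "x = y \<longleftrightarrow> x TopC = y TopC \<and> x LeftC = y LeftC \<and> x RightC = y RightC"
  by (simp add: fun_eq_iff all_corner)

lemma tri_sum: "t \<in> tri n \<Longrightarrow> t TopC + t LeftC + t RightC + 1 = 2 ^ n"
proof (induction n arbitrary: t)
  case (Suc n)
  then obtain t' c where "t' \<in> tri n" "t = (\<lambda>k. 2 * t' k + delta c k)" by auto
  with Suc.IH[of t'] show ?case by (cases c) (simp_all add: delta_def)
qed simp

text \<open>The recursion of \<open>tri\<close> refines: it appends a lowest binary digit.
  Prepending a highest digit gives the same set, and this is the form that matches the construction
  of \<open>ST\<close> from three copies.\<close>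

lemma tri_Suc_high: "tri (Suc n) = (\<Union>c. (\<lambda>t k. 2 ^ n * delta c k + t k) ` tri n)"
proof (induction n)
  case (Suc n)
  have "tri (Suc (Suc n)) = (\<Union>c. (\<lambda>t k. 2 * t k + delta c k) ` tri (Suc n))"
    by (rule tri.simps)
  also have "\<dots> = (\<Union>c. \<Union>d. (\<lambda>t k. 2 * (2 ^ n * delta d k + t k) + delta c k) ` tri n)"
    unfolding Suc image_UN image_image ..
  also have "\<dots> = (\<Union>d. \<Union>c. (\<lambda>t k. 2 ^ Suc n * delta d k + (2 * t k + delta c k)) ` tri n)"
    by (subst SUP_commute) (simp add: algebra_simps)
  also have "\<dots> = (\<Union>d. (\<lambda>t k. 2 ^ Suc n * delta d k + t k) ` tri (Suc n))"
    by (simp add: image_UN image_image)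
  finally show ?case .
qed (simp)

lemma pverts_gasket: "pverts (gasket n) = (\<Union>i. (\<lambda>t k. t k + delta i k) ` tri n)"
  by (simp add: gasket_def)

lemma parcs_gasket:
  "parcs (gasket n) =
     (\<Union>i. \<Union>j\<in>-{i}. (\<lambda>t. (\<lambda>k. t k + delta i k, \<lambda>k. t k + delta j k)) ` tri n)"
  by (simp add: gasket_def)

lemma pverts_gasket_sum:
  "x \<in> pverts (gasket n) \<Longrightarrow> x TopC + x LeftC + x RightC = 2 ^ n"
proof -
  assume "x \<in> pverts (gasket n)"
  then obtain t i where "t \<in> tri n" "x = (\<lambda>k. t k + delta i k)" by (auto simp: pverts_gasket)
  with tri_sum[of t n] show ?thesis by (cases i) (simp_all add: delta_def)
qed

section \<open>The three translated copies and the isomorphism with \<open>ST n\<close>\<close>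

definition corner_pt :: "nat \<Rightarrow> corner \<Rightarrow> corner \<Rightarrow> nat" where
  "corner_pt n c k = 2 ^ n * delta c k"

lemma corner_pt_unique:
  assumes "x \<in> pverts (gasket n)" "x c \<ge> 2 ^ n"
  shows "x = corner_pt n c"
  using pverts_gasket_sum[OF assms(1)] assms(2)
  by (cases c) (auto simp: point_eq_iff corner_pt_def delta_def)

definition shift :: "nat \<Rightarrow> corner \<Rightarrow> (corner \<Rightarrow> nat) \<Rightarrow> corner \<Rightarrow> nat" where
  "shift n c x = (\<lambda>k. 2 ^ n * delta c k + x k)"

lemma pverts_gasket_Suc: "pverts (gasket (Suc n)) = (\<Union>c. shift n c ` pverts (gasket n))"
  unfolding pverts_gasket tri_Suc_high image_UN image_image shift_def
  by (subst SUP_commute) (simp add: add.assoc)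

lemma parcs_gasket_Suc:
  "parcs (gasket (Suc n)) = (\<Union>c. map_prod (shift n c) (shift n c) ` parcs (gasket n))"
  unfolding parcs_gasket tri_Suc_high image_UN image_image shift_def
  by (simp add: add.assoc) blast

lemma parcs_gasket_verts: "parcs (gasket n) \<subseteq> pverts (gasket n) \<times> pverts (gasket n)"
  unfolding parcs_gasket pverts_gasket by blast

text \<open>In a word of \<open>ST n\<close> all letters but the last spell an elementary triangle,
  highest binary digit first, and the last letter selects its vertex. The truncated
  \<open>length v - 1\<close> gives the last two letters the same weight 1.\<close>

primrec pos :: "corner list \<Rightarrow> corner \<Rightarrow> nat" where
  "pos [] = (\<lambda>_. 0)"
| "pos (c # v) = (\<lambda>k. 2 ^ (length v - 1) * delta c k + pos v k)"

lemma length_ST: "v \<in> pverts (ST n) \<Longrightarrow> length v = Suc n"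
proof (induction n arbitrary: v)
  case (Suc n)
  then obtain c w where w: "w \<in> pverts (ST n)" "v = identify (extreme n) (c # w)"
    unfolding pverts_ST_Suc by blast
  with Suc.IH[of w] show ?case by (auto simp: identify_def extreme_eq)
qed (auto simp: extreme_eq)

lemma pos_extreme: "pos (extreme n c) = corner_pt n c"
proof (induction n)
  case (Suc n)
  have "pos (extreme (Suc n) c) = (\<lambda>k. 2 ^ n * delta c k + pos (extreme n c) k)"
    by (simp add: extreme_eq)
  with Suc show ?case by (simp add: corner_pt_def fun_eq_iff)
qed (simp add: corner_pt_def delta_def fun_eq_iff)

lemma pos_Cons:
  assumes "v \<in> pverts (ST n)"
  shows "pos (c # v) = shift n c (pos v)"
  using length_ST[OF assms] by (simp add: shift_def)

text \<open>Corner \<open>e\<close> of copy \<open>d\<close> and corner \<open>d\<close> of copy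
  \<open>e\<close> have the same coordinates, so replacing one word of an identified pair by the
  other does not change \<open>pos\<close>.\<close>

lemma pos_identify:
  assumes "v \<in> pverts (ST n)"
  shows "pos (identify (extreme n) (c # v)) = shift n c (pos v)"
proof -
  have "pos (d # extreme n e) = (\<lambda>k. 2 ^ n * delta d k + 2 ^ n * delta e k)" for d e
    using pos_Cons[OF extreme_in_ST[of n e], of d]
    by (simp add: pos_extreme corner_pt_def shift_def)
  then show ?thesis
    using pos_Cons[OF assms, of c]
    by (auto simp: identify_def pos_extreme corner_pt_def shift_def)
qed

lemma pos_image_pverts: "pos ` pverts (ST n) = pverts (gasket n)"
proof (induction n)
  case 0
  show ?case by (auto simp: pverts_gasket image_iff)
next
  case (Suc n)
  have "pverts (ST (Suc n)) = (\<Union>c. (\<lambda>v. identify (extreme n) (c # v)) ` pverts (ST n))"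
    unfolding pverts_ST_Suc by blast
  then have "pos ` pverts (ST (Suc n)) =
      (\<Union>c. (\<lambda>v. pos (identify (extreme n) (c # v))) ` pverts (ST n))"
    by (simp only: image_UN image_image)
  also have "\<dots> = (\<Union>c. (\<lambda>v. shift n c (pos v)) ` pverts (ST n))"
    by (intro SUP_cong image_cong refl pos_identify)
  also have "\<dots> = pverts (gasket (Suc n))"
    unfolding pverts_gasket_Suc Suc[symmetric] image_image ..
  finally show ?case .
qed

lemma ST_arcs_verts: "parcs (ST n) \<subseteq> pverts (ST n) \<times> pverts (ST n)"
proof -
  interpret pair_graph "ST n" by (rule pair_graph_ST)
  show ?thesis using in_arcsD1 in_arcsD2 by auto
qed

lemma pos_image_parcs: "map_prod pos pos ` parcs (ST n) = parcs (gasket n)"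
proof (induction n)
  case 0
  have "parcs (ST 0) = (\<Union>i. \<Union>j\<in>-{i}. {([i], [j])})" by auto
  then show ?case by (simp add: parcs_gasket image_UN)
next
  case (Suc n)
  have "parcs (ST (Suc n)) = (\<Union>c. (\<lambda>(u, v). (identify (extreme n) (c # u), identify (extreme n) (c # v))) ` parcs (ST n))"
    unfolding parcs_ST_Suc by auto
  then have "map_prod pos pos ` parcs (ST (Suc n)) =
      (\<Union>c. (\<lambda>e. (pos (identify (extreme n) (c # fst e)), pos (identify (extreme n) (c # snd e)))) ` parcs (ST n))"
    by (simp only: image_UN image_image map_prod_def case_prod_unfold fst_conv snd_conv)
  also have "\<dots> = (\<Union>c. (\<lambda>e. (shift n c (pos (fst e)), shift n c (pos (snd e)))) ` parcs (ST n))"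
    using ST_arcs_verts[of n]
    by (intro SUP_cong image_cong refl arg_cong2[where f = Pair] pos_identify) auto
  also have "\<dots> = parcs (gasket (Suc n))"
    unfolding parcs_gasket_Suc Suc[symmetric] image_image map_prod_def case_prod_unfold fst_conv snd_conv ..
  finally show ?case .
qed

text \<open>Two different translated copies meet only in a point that is extreme in both, and there
  \<open>identify\<close> merges the two words.\<close>

lemma inj_pos: "inj_on pos (pverts (ST n))"
proof (induction n)
  case 0
  show ?case by (auto simp: inj_on_def fun_eq_iff delta_def split: if_splits; metis)
next
  case (Suc n)
  have ext: "v = extreme n d" if "v \<in> pverts (ST n)" "pos v d \<ge> 2 ^ n" for v d
  proof -
    have "pos v = pos (extreme n d)"
      using corner_pt_unique[of "pos v" n d] that pos_image_pverts[of n] by (auto simp: pos_extreme)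
    then show ?thesis using inj_onD[OF Suc] that(1) extreme_in_ST by blast
  qed
  show ?case
  proof (rule inj_onI)
    fix x y assume "x \<in> pverts (ST (Suc n))" "y \<in> pverts (ST (Suc n))" and eq: "pos x = pos y"
    then obtain c v d w where v: "v \<in> pverts (ST n)" "x = identify (extreme n) (c # v)"
      and w: "w \<in> pverts (ST n)" "y = identify (extreme n) (d # w)"
      unfolding pverts_ST_Suc by blast
    have "shift n c (pos v) = shift n d (pos w)"
      using eq pos_identify[OF v(1), of c] pos_identify[OF w(1), of d] v(2) w(2) by simp
    then have e: "2 ^ n * delta c k + pos v k = 2 ^ n * delta d k + pos w k" for k
      by (simp add: shift_def fun_eq_iff)
    show "x = y"
    proof (cases "c = d")
      case True
      then have "pos v = pos w" using e by (simp add: fun_eq_iff)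
      then show ?thesis using True v w inj_onD[OF Suc] by blast
    next
      case False
      \<comment> \<open>At the indices \<open>d\<close> and \<open>c\<close> the summand
        \<open>2 ^ n\<close> occurs on one side only, so the point on the other side has to make up
        for it.\<close>
      then have "pos v d \<ge> 2 ^ n" "pos w c \<ge> 2 ^ n"
        using e[of d] e[of c] by (simp_all add: delta_def)
      then have "v = extreme n d" "w = extreme n c" using ext v(1) w(1) by blast+
      with False v(2) w(2) show ?thesis
        by (cases c; cases d) (simp_all add: identify_eq_iff[OF inj_extreme] doubleton_eq_iff)
    qed
  qed
qed

lemma mu_d_ST: "mu_d (with_proj (ST n)) = mu_d (with_proj (gasket n))"
proof -
  interpret digraph_iso "ST n" "gasket n" pos
    by unfold_locales (simp_all only: inj_pos pos_image_pverts pos_image_parcs ST_arcs_verts)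
  show ?thesis by (rule mu_d_eq)
qed

section \<open>Local structure\<close>

text \<open>
  For \<open>t \<in> tri n\<close> the points \<open>pt t i j\<close> are the vertices of a copy of the graph of level 1 in
  \<open>gasket (Suc n)\<close>: its corners are the \<open>pt t i i\<close>, the midpoints of its sides the others.
\<close>

definition pt :: "(corner \<Rightarrow> nat) \<Rightarrow> corner \<Rightarrow> corner \<Rightarrow> corner \<Rightarrow> nat" where
  "pt t i j = (\<lambda>k. 2 * t k + delta i k + delta j k)"

lemma pt_commute: "pt t i j = pt t j i"
  by (simp add: pt_def fun_eq_iff)


lemma vert_Suc_iff:
  "x \<in> pverts (gasket (Suc n)) \<longleftrightarrow> (\<exists>t\<in>tri n. \<exists>i j. x = pt t i j)"
  unfolding pverts_gasket tri.simps image_UN image_image pt_def by (auto simp: image_iff)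

lemma pt_vert: "t \<in> tri n \<Longrightarrow> pt t i j \<in> pverts (gasket (Suc n))"
  unfolding vert_Suc_iff by blast

lemma arc_iff:
  "(x, y) \<in> parcs (gasket n) \<longleftrightarrow>
     (\<exists>t\<in>tri n. \<exists>i j. i \<noteq> j \<and> x = (\<lambda>k. t k + delta i k) \<and> y = (\<lambda>k. t k + delta j k))"
  (is "_ \<longleftrightarrow> ?R")
proof
  assume "(x, y) \<in> parcs (gasket n)"
  then obtain i j t where t: "j \<in> - {i}" "t \<in> tri n" "x = (\<lambda>k. t k + delta i k)"
    "y = (\<lambda>k. t k + delta j k)"
    unfolding parcs_gasket by (elim UN_E imageE) simp
  from t(1) have "i \<noteq> j" by blast
  with t(2-) show ?R by blast
next
  assume ?R
  then obtain t i j where t: "t \<in> tri n" "i \<noteq> j" "x = (\<lambda>k. t k + delta i k)" "y = (\<lambda>k. t k + delta j k)"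
    by blast
  then show "(x, y) \<in> parcs (gasket n)"
    unfolding parcs_gasket by (intro UN_I[of i] UN_I[of j] image_eqI[OF _ t(1)]) auto
qed

lemma arc_Suc_iff:
  "(x, y) \<in> parcs (gasket (Suc n)) \<longleftrightarrow>
     (\<exists>t\<in>tri n. \<exists>c i j. i \<noteq> j \<and> x = pt t c i \<and> y = pt t c j)"
  unfolding arc_iff tri.simps pt_def by (simp add: image_iff) blast

lemma pt_arc: "t \<in> tri n \<Longrightarrow> i \<noteq> j \<Longrightarrow> (pt t c i, pt t c j) \<in> parcs (gasket (Suc n))"
  unfolding arc_Suc_iff by blast

lemma sym_gasket: "sym (parcs (gasket n))"
  unfolding sym_def arc_iff by metis

lemma arc_verts:
  "(x, y) \<in> parcs (gasket n) \<Longrightarrow> x \<in> pverts (gasket n) \<and> y \<in> pverts (gasket n)"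
  using parcs_gasket_verts by blast

text \<open>Parity separates the corners of a block, that is, of a copy of the level 1 graph, from
  its midpoints, and recovers the side on which a midpoint lies.\<close>

lemma even_pt: "even (pt t i j k) \<longleftrightarrow> i = j \<or> k \<noteq> i \<and> k \<noteq> j"
  by (auto simp: pt_def delta_def)

text \<open>The odd coordinates determine the side, after which the block follows by cancellation.
  Hence a midpoint belongs to a single block.\<close>

lemma mid_eq_pt:
  assumes "pt t i j = pt s k l" "i \<noteq> j"
  shows "s = t \<and> (k = i \<and> l = j \<or> k = j \<and> l = i)"
proof -
  have "(i = j \<or> m \<noteq> i \<and> m \<noteq> j) \<longleftrightarrow> (k = l \<or> m \<noteq> k \<and> m \<noteq> l)" for m
    using assms(1) even_pt by metis
  with assms(2) have "k = i \<and> l = j \<or> k = j \<and> l = i" by metis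
  with assms(1) show ?thesis by (auto simp: pt_def fun_eq_iff)
qed

text \<open>A corner may be shared by several blocks, so only its halved coordinates can be
  compared.\<close>

lemma corner_eq_pt:
  assumes "pt t i i = pt s k l"
  shows "k = l" "t m + delta i m = s m + delta k m"
proof -
  show "k = l" using assms even_pt by metis
  then have "2 * (t m + delta i m) = 2 * (s m + delta k m)"
    using fun_cong[OF assms, of m] by (simp add: pt_def)
  then show "t m + delta i m = s m + delta k m" by simp
qed

lemma delta_eq_iff [simp]: "delta i = delta j \<longleftrightarrow> i = j"
  by (auto simp: delta_def fun_eq_iff split: if_splits)

lemma corner_eq_pt_same:
  assumes "pt t i i = pt t k l"
  shows "k = i" "l = i"
proof -
  have "delta i = delta k" using corner_eq_pt(2)[OF assms] by (simp add: fun_eq_iff)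
  with corner_eq_pt(1)[OF assms] show "k = i" "l = i" by simp_all
qed

text \<open>Since a midpoint lies in only one block, the triangle containing the edge lies in that
  block, at one of the two ends of the side.\<close>

lemma mid_arc:
  assumes "(pt t i j, z) \<in> parcs (gasket (Suc n))" "i \<noteq> j"
  obtains e where "z = pt t i e" "e \<noteq> j" | e where "z = pt t j e" "e \<noteq> i"
  using assms mid_eq_pt unfolding arc_Suc_iff by blast

lemma mid_arc_block:
  assumes "(pt t i j, z) \<in> parcs (gasket (Suc n))" "i \<noteq> j"
  obtains k l where "z = pt t k l"
  using assms by (metis mid_arc)

lemma corner_arc:
  assumes "(pt t i i, z) \<in> parcs (gasket (Suc n))"
  obtains s k l where "s \<in> tri n" "k \<noteq> l" "z = pt s k l" "pt t i i = pt s k k"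
  using assms corner_eq_pt(1) unfolding arc_Suc_iff by metis

lemma corner_arc_block:
  assumes "(pt t i i, z) \<in> parcs (gasket (Suc n))" "z = pt t k l"
  obtains j where "j \<noteq> i" "z = pt t i j"
proof -
  obtain s a b where s: "a \<noteq> b" "z = pt s a b" "pt t i i = pt s a a"
    using corner_arc[OF assms(1)] by metis
  then have "s = t" using mid_eq_pt assms(2) by metis
  with s corner_eq_pt_same show thesis using that by metis
qed

text \<open>An edge moves one unit between two coordinates; additions on both sides avoid
  subtraction of naturals.\<close>

lemma arc_shift:
  assumes "(x, y) \<in> parcs (gasket n)"
  obtains a b where "a \<noteq> b" "\<And>k. x k + delta a k = y k + delta b k"
proof -
  obtain t i j where "i \<noteq> j" "x = (\<lambda>k. t k + delta i k)" "y = (\<lambda>k. t k + delta j k)"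
    using assms unfolding arc_iff by blast
  then show thesis using that[of j i] by simp
qed

text \<open>The two corners differ by two units moved from \<open>i\<close> to \<open>j\<close>, so
  each of the two edges must move one unit from \<open>i\<close> to \<open>j\<close>.\<close>

lemma corners_common_neighbour:
  assumes "(pt t i i, z) \<in> parcs (gasket (Suc n))" "(z, pt t j j) \<in> parcs (gasket (Suc n))" "i \<noteq> j"
  shows "z = pt t i j"
proof -
  obtain a b where ab: "a \<noteq> b" "\<And>k. pt t i i k + delta a k = z k + delta b k"
    using arc_shift[OF assms(1)] by metis
  obtain c d where cd: "c \<noteq> d" "\<And>k. z k + delta c k = pt t j j k + delta d k"
    using arc_shift[OF assms(2)] by metis
  have "b = i"
    using ab(1) ab(2)[of i] cd(2)[of i] assms(3) by (auto simp: pt_def delta_def split: if_splits)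
  moreover have "a = j"
    using ab(1) ab(2)[of j] cd(1) cd(2)[of j] assms(3) by (auto simp: pt_def delta_def split: if_splits)
  ultimately have "z k = pt t i j k" for k using ab(2)[of k] by (simp add: pt_def)
  then show ?thesis by blast
qed

section \<open>Two blocks sharing a corner\<close>

locale junction =
  fixes n :: nat and t t' :: "corner \<Rightarrow> nat" and i k :: corner and w
  assumes t: "t \<in> tri n" and t': "t' \<in> tri n" and neq: "t \<noteq> t'"
    and w: "w = pt t i i" and w': "w = pt t' k k"
begin

text \<open>By parity a common point is a corner of both blocks. As \<open>t'\<close> exceeds
  \<open>t\<close> by one in coordinate \<open>i\<close>, only the corner \<open>i\<close> of
  \<open>t\<close> can make up the difference.\<close>

lemma block_inter:
  assumes "pt t a b = pt t' c d"
  shows "pt t a b = w"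
proof -
  have "a = b" using assms mid_eq_pt neq by metis
  have e: "t m + delta a m = t' m + delta c m" "t m + delta i m = t' m + delta k m" for m
    using assms \<open>a = b\<close> corner_eq_pt[of t a t' c d] w w' corner_eq_pt[of t i t' k k] by auto
  have "i \<noteq> k" using e(2) neq by auto
  then have "a = i" using e[of i] by (auto simp: delta_def split: if_splits)
  with \<open>a = b\<close> w show ?thesis by simp
qed

lemma mids_common_neighbour:
  assumes "j \<noteq> i" "l \<noteq> k" "(pt t i j, z) \<in> parcs (gasket (Suc n))"
    "(z, pt t' k l) \<in> parcs (gasket (Suc n))"
  shows "z = w"
proof -
  obtain a b where "z = pt t a b" using mid_arc_block[OF assms(3)] assms(1) by metis
  moreover obtain c d where "z = pt t' c d"
    using mid_arc_block[OF symD[OF sym_gasket assms(4)]] assms(2) by metis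
  ultimately show ?thesis using block_inter by metis
qed

text \<open>Here \<open>x\<close> lies in the block of \<open>t\<close> and \<open>y\<close> in that
  of \<open>t'\<close>. One end of the edge between them is a midpoint, and its block contains the
  other end too; so one of them lies in both blocks.\<close>

lemma three_walk:
  assumes "j \<noteq> m" "l \<noteq> k" "(pt t j m, x) \<in> parcs (gasket (Suc n))"
    "(x, y) \<in> parcs (gasket (Suc n))" "(y, pt t' k l) \<in> parcs (gasket (Suc n))"
  shows "x = w \<or> y = w"
proof -
  obtain a b where x: "x = pt t a b" using mid_arc_block[OF assms(3,1)] by metis
  obtain c d where y: "y = pt t' c d"
    using mid_arc_block[OF symD[OF sym_gasket assms(5)]] assms(2) by metis
  show ?thesis
  proof (cases "a = b")
    case False
    then obtain e f where "y = pt t e f" using mid_arc_block assms(4) x by metis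
    with y block_inter show ?thesis by metis
  next
    case True
    then have "c \<noteq> d" using corner_arc assms(4) mid_eq_pt x y by metis
    then obtain e f where "x = pt t' e f"
      using mid_arc_block[OF symD[OF sym_gasket assms(4), unfolded y]] by metis
    with x block_inter show ?thesis by metis
  qed
qed

end

section \<open>Side paths\<close>

definition side :: "nat \<Rightarrow> corner \<Rightarrow> corner \<Rightarrow> nat \<Rightarrow> corner \<Rightarrow> nat" where
  "side n a b m = (\<lambda>k. (2 ^ n - m) * delta a k + m * delta b k)"

definition near :: "nat \<Rightarrow> corner \<Rightarrow> corner \<Rightarrow> corner \<Rightarrow> nat" where
  "near n a b = (\<lambda>k. (2 ^ n - 1) * delta a k + delta b k)"

lemma tri_SucI: "t \<in> tri n \<Longrightarrow> (\<lambda>k. 2 * t k + delta c k) \<in> tri (Suc n)"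
  by auto

text \<open>In binary, \<open>i\<close> and \<open>j\<close> are complementary: exactly one of them
  is odd and supplies the lowest digit of the triangle, and halving gives the induction
  step.\<close>

lemma side_in_tri:
  "i + j + 1 = 2 ^ n \<Longrightarrow> (\<lambda>k. i * delta a k + j * delta b k) \<in> tri n"
proof (induction n arbitrary: i j)
  case (Suc n)
  have "odd (i + j)" using Suc.prems
    by (metis add.commute even_add even_power odd_one zero_less_Suc even_numeral)
  then consider "odd i" "even j" | "even i" "odd j" by fastforce
  then show ?case
  proof cases
    case 1
    then obtain i' j' where ij: "i = 2 * i' + 1" "j = 2 * j'" by (meson evenE oddE)
    with Suc.prems have "i' + j' + 1 = 2 ^ n" by simp
    from tri_SucI[OF Suc.IH[OF this], of a] show ?thesis by (simp add: ij algebra_simps)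
  next
    case 2
    then obtain i' j' where ij: "i = 2 * i'" "j = 2 * j' + 1" by (meson evenE oddE)
    with Suc.prems have "i' + j' + 1 = 2 ^ n" by simp
    from tri_SucI[OF Suc.IH[OF this], of b] show ?thesis by (simp add: ij algebra_simps)
  qed
qed simp

lemma side_arc:
  assumes "m < 2 ^ n" "a \<noteq> b"
  shows "(side n a b m, side n a b (Suc m)) \<in> parcs (gasket n)"
proof -
  define t where "t = (\<lambda>k. (2 ^ n - Suc m) * delta a k + m * delta b k)"
  have "t \<in> tri n" unfolding t_def by (rule side_in_tri) (use assms in simp)
  moreover have "side n a b m = (\<lambda>k. t k + delta a k)" "side n a b (Suc m) = (\<lambda>k. t k + delta b k)"
    using assms by (auto simp: side_def t_def fun_eq_iff Suc_diff_Suc[symmetric])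
  ultimately show ?thesis using assms(2) unfolding arc_iff by blast
qed

lemma side_0: "side n a b 0 = corner_pt n a"
  and side_max: "side n a b (2 ^ n) = corner_pt n b"
  by (simp_all add: side_def corner_pt_def fun_eq_iff)

lemma side_walk:
  assumes "m \<le> 2 ^ n" "a \<noteq> b"
  shows "walk (with_proj (gasket n)) (corner_pt n a) (map (side n a b) [0..<Suc m]) (side n a b m)"
  using assms(1)
proof (induction m)
  case 0
  have "side n a b 0 \<in> pverts (gasket n)" using side_arc[of 0 n a b] assms arc_verts by auto
  then show ?case by (simp add: walk_iff side_0)
next
  case (Suc m)
  have "(side n a b m, side n a b (Suc m)) \<in> parcs (gasket n)"
    using side_arc[of m n a b] Suc.prems assms(2) by simp
  moreover from this have "side n a b (Suc m) \<in> pverts (gasket n)" using arc_verts by blast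
  moreover have "hd (map (side n a b) [0..<Suc m]) = corner_pt n a"
    by (simp add: hd_map side_0 del: upt_Suc)
  moreover have "last (map (side n a b) [0..<Suc m]) = side n a b m" by simp
  ultimately show ?case
    using Suc unfolding upt_Suc_append[OF le0, of "Suc m"] map_append
    by (auto simp: walk_iff successively_append_iff hd_append simp del: upt_Suc)
qed

text \<open>Each edge changes a coordinate by at most 1, and there is one edge fewer than vertices,
  whence the \<open>+ 1\<close>. This yields the lower bounds on distances.\<close>

lemma walk_coordinate:
  assumes "walk (with_proj (gasket n)) u p v"
  shows "u k + 1 \<le> v k + length p" "v k + 1 \<le> u k + length p"
proof -
  have step: "x k \<le> y k + 1" if "(x, y) \<in> parcs (gasket n)" for x y
  proof -
    obtain a b where "x k + delta a k = y k + delta b k" using arc_shift[OF \<open>(x, y) \<in> _\<close>] by blast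
    moreover have "delta b k \<le> 1" by (simp add: delta_def)
    ultimately show ?thesis by linarith
  qed
  have "hd p k + 1 \<le> last p k + length p \<and> last p k + 1 \<le> hd p k + length p"
    if "p \<noteq> []" "successively (\<lambda>x y. (x, y) \<in> parcs (gasket n)) p"
    using that
  proof (induction p rule: list_nonempty_induct)
    case (cons x xs)
    then have "(x, hd xs) \<in> parcs (gasket n)" by (simp add: successively_Cons)
    from step[OF this] step[OF symD[OF sym_gasket this]] cons show ?case
      by (auto simp: successively_Cons)
  qed simp
  with assms show "u k + 1 \<le> v k + length p" "v k + 1 \<le> u k + length p"
    by (auto simp: walk_iff)
qed

text \<open>The vanishing coordinates of an extreme vertex force every triangle through it to be the
  outermost one.\<close>

lemma corner_pt_arc:
  assumes "(corner_pt n a, x) \<in> parcs (gasket n)"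
  obtains b where "b \<noteq> a" "x = near n a b"
proof -
  obtain t i j where t: "i \<noteq> j" "corner_pt n a = (\<lambda>k. t k + delta i k)" "x = (\<lambda>k. t k + delta j k)"
    using assms unfolding arc_iff by blast
  have e: "2 ^ n * delta a k = t k + delta i k" for k
    using t(2) by (simp add: corner_pt_def fun_eq_iff)
  have "i = a" using e[of i] by (auto simp: delta_def split: if_splits)
  then have "t k = (2 ^ n - 1) * delta a k" for k
    using e[of k] by (auto simp: delta_def split: if_splits)
  with t \<open>i = a\<close> show thesis by (intro that[of j]) (auto simp: near_def)
qed

lemma corner_pt_vert: "corner_pt n a \<in> pverts (gasket n)"
  using pos_image_pverts[of n] extreme_in_ST[of n a] pos_extreme[of n a] by force

lemma corner_pt_eq_iff: "corner_pt n a = corner_pt n b \<longleftrightarrow> a = b"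
proof
  assume "corner_pt n a = corner_pt n b"
  from fun_cong[OF this, of a] show "a = b"
    by (auto simp: corner_pt_def delta_def split: if_splits)
qed simp

lemma near_ne_corner_pt:
  assumes "n > 0" "b \<noteq> a"
  shows "near n a b \<noteq> corner_pt n c"
proof
  assume eq: "near n a b = corner_pt n c"
  have "(2::nat) ^ n \<ge> 2" using assms(1) by (cases n) auto
  with fun_cong[OF eq, of a] fun_cong[OF eq, of b] assms(2) show False
    by (auto simp: near_def corner_pt_def delta_def split: if_splits)
qed

text \<open>Leaving \<open>a\<close> in any other direction keeps the \<open>b\<close>-coordinate 0 and wastes a step.\<close>

lemma visible_corners_near:
  assumes vis: "visible (with_proj (gasket n)) M (corner_pt n a) (corner_pt n b)"
    and "a \<noteq> b" "n > 0"
  shows "near n a b \<notin> M"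
proof -
  let ?G = "with_proj (gasket n)"
  have "walk ?G (corner_pt n a) (map (side n a b) [0..<Suc (2 ^ n)]) (corner_pt n b)"
    using side_walk[of "2 ^ n" n a b] assms(2) by (simp add: side_max del: upt_Suc)
  then obtain p where p: "walk ?G (corner_pt n a) p (corner_pt n b)"
    "length p \<le> length (map (side n a b) [0..<Suc (2 ^ n)])"
    "set p \<inter> (M - {corner_pt n a, corner_pt n b}) = {}"
    by (rule visibleD[OF vis])
  have ne: "corner_pt n a \<noteq> corner_pt n b" using assms(2) by (simp add: corner_pt_eq_iff)
  then obtain x q where q: "p = corner_pt n a # x # q"
    using p(1) by (cases p rule: vwalk_arcs.cases) (auto simp: walk_iff)
  have arc: "(corner_pt n a, x) \<in> parcs (gasket n)" and w: "walk ?G x (x # q) (corner_pt n b)"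
    using p(1) by (auto simp: q walk_iff)
  obtain c where c: "c \<noteq> a" "x = near n a c" using corner_pt_arc[OF arc] .
  have "c = b"
  proof (rule ccontr)
    assume "c \<noteq> b"
    with assms(2) c have "x b = 0" by (simp add: near_def delta_def)
    moreover have "corner_pt n b b + 1 \<le> x b + length (x # q)" using walk_coordinate(2)[OF w] .
    ultimately show False using p(2) by (simp add: q corner_pt_def delta_def)
  qed
  with c p(3) q near_ne_corner_pt[OF assms(3) c(1)] show ?thesis by auto
qed

section \<open>The upper bound\<close>

text \<open>Under refinement the child at \<open>c\<close> shares its corner \<open>i\<close> with
  the child at \<open>i\<close> if these differ. The child at \<open>i\<close> keeps the corner
  \<open>i\<close> of its parent, to which the induction hypothesis applies.\<close>

lemma tri_junction:
  "t \<in> tri n \<Longrightarrow> (\<lambda>k. t k + delta i k) = corner_pt n i \<or>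
     (\<exists>t'\<in>tri n. \<exists>c. t' \<noteq> t \<and> (\<lambda>k. t k + delta i k) = (\<lambda>k. t' k + delta c k))"
proof (induction n arbitrary: t)
  case (Suc n)
  then obtain s c where s: "s \<in> tri n" "t = (\<lambda>k. 2 * s k + delta c k)" by auto
  show ?case
  proof (cases "c = i")
    case False
    have "(\<lambda>k. 2 * s k + delta i k) \<in> tri (Suc n)" using s(1) by auto
    moreover have "(\<lambda>k. 2 * s k + delta i k) \<noteq> t"
      using False s(2) delta_eq_iff[of i c] by (auto simp: fun_eq_iff)
    moreover have "(\<lambda>k. t k + delta i k) = (\<lambda>k. (2 * s k + delta i k) + delta c k)"
      by (simp add: s(2) add_ac)
    ultimately show ?thesis by blast
  next
    case True
    from Suc.IH[OF s(1)] show ?thesis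
    proof (elim disjE bexE exE conjE)
      assume "(\<lambda>k. s k + delta i k) = corner_pt n i"
      then have e: "s k + delta i k = corner_pt n i k" for k by (simp add: fun_eq_iff)
      have "t k + delta i k = 2 * (s k + delta i k)" for k using True s(2) by simp
      then have "t k + delta i k = corner_pt (Suc n) i k" for k
        unfolding e by (simp add: corner_pt_def)
      then show ?thesis by blast
    next
      fix s' d assume s': "s' \<in> tri n" "s' \<noteq> s" "(\<lambda>k. s k + delta i k) = (\<lambda>k. s' k + delta d k)"
      have "(\<lambda>k. 2 * s' k + delta d k) \<in> tri (Suc n)" using s'(1) by auto
      moreover have e: "t k + delta i k = (2 * s' k + delta d k) + delta d k" for k
        using fun_cong[OF s'(3), of k] True s(2) by simp
      moreover have "(\<lambda>k. 2 * s' k + delta d k) \<noteq> t"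
      proof
        assume eq: "(\<lambda>k. 2 * s' k + delta d k) = t"
        then have "delta i k = delta d k" for k using e[of k] by auto
        then have "i = d" using delta_eq_iff[of i d] by blast
        with s'(2,3) show False by (simp add: fun_eq_iff)
      qed
      ultimately show ?thesis by blast
    qed
  qed
qed (simp add: corner_pt_def fun_eq_iff)

lemma other_corner: obtains j :: corner where "j \<noteq> i"
  by (metis corner.distinct(1))

lemma two_other_corners: obtains j m :: corner where "j \<noteq> i" "m \<noteq> i" "j \<noteq> m"
  by (metis corner.distinct(1,3,5) corner.exhaust)

section \<open>Dual mutual-visibility sets contain no junction\<close>

locale dual_set =
  fixes n :: nat and M
  assumes dual: "dual_mutual_visibility_set (with_proj (gasket (Suc n))) M"
begin

abbreviation "G \<equiv> with_proj (gasket (Suc n))"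

lemma subset: "M \<subseteq> pverts (gasket (Suc n))"
  using dual by (simp add: dual_mutual_visibility_set_def)

text \<open>The equivalence in the last assumption treats pairs inside \<open>M\<close> and pairs
  outside \<open>M\<close> alike.\<close>

lemma visible_same:
  assumes "u \<in> pverts (gasket (Suc n))" "v \<in> pverts (gasket (Suc n))" "u \<noteq> v" "u \<in> M \<longleftrightarrow> v \<in> M"
  shows "visible G M u v"
  using dual assms by (auto simp: dual_mutual_visibility_set_def)

lemma same_common_neighbour:
  assumes "u \<noteq> v" "u \<in> M \<longleftrightarrow> v \<in> M" "(u, v) \<notin> parcs (gasket (Suc n))"
    and "(u, w) \<in> parcs (gasket (Suc n))" "(w, v) \<in> parcs (gasket (Suc n))"
  obtains x where "(u, x) \<in> parcs (gasket (Suc n))" "(x, v) \<in> parcs (gasket (Suc n))"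
    "x \<notin> M - {u, v}"
proof -
  have V: "u \<in> pverts (gasket (Suc n))" "v \<in> pverts (gasket (Suc n))" "w \<in> pverts (gasket (Suc n))"
    using assms arc_verts by blast+
  from visible_common_neighbour[OF visible_same[OF V(1,2) assms(1,2)], of w] assms V that
  show thesis by auto
qed

text \<open>
  A junction is the only common neighbour of midpoints on its two sides, so if it is in \<open>M\<close> it
  blocks two such midpoints from each other, whether both are in \<open>M\<close> or both outside.
\<close>

lemma junction_separates:
  assumes "junction n t t' i k w" "w \<in> M" "j \<noteq> i" "l \<noteq> k"
  shows "pt t i j \<in> M \<longleftrightarrow> pt t' k l \<notin> M"
proof (rule ccontr)
  interpret junction n t t' i k w by fact
  assume "\<not> ?thesis"
  then have same: "pt t i j \<in> M \<longleftrightarrow> pt t' k l \<in> M" by blast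
  have ne: "pt t i j \<noteq> pt t' k l" using mid_eq_pt neq assms(3) by metis
  have no_arc: "(pt t i j, pt t' k l) \<notin> parcs (gasket (Suc n))"
    using mid_arc_block mid_eq_pt neq assms(3,4) by metis
  have "(pt t i j, w) \<in> parcs (gasket (Suc n))" "(w, pt t' k l) \<in> parcs (gasket (Suc n))"
    using pt_arc[OF t, of j i i] pt_arc[OF t', of k l k] assms(3,4) w w' by auto
  then obtain x where "(pt t i j, x) \<in> parcs (gasket (Suc n))"
    "(x, pt t' k l) \<in> parcs (gasket (Suc n))" "x \<notin> M - {pt t i j, pt t' k l}"
    by (rule same_common_neighbour[OF ne same no_arc])
  moreover from this have "x = w" using mids_common_neighbour assms(3,4) by metis
  moreover have "w \<noteq> pt t i j" "w \<noteq> pt t' k l"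
    using mid_eq_pt assms(3,4) w w' by metis+
  ultimately show False using assms(2) by blast
qed

lemma junction_one_sided:
  assumes "junction n t t' i k w" "w \<in> M" "\<And>j. j \<noteq> i \<Longrightarrow> pt t i j \<in> M"
    "\<And>l. l \<noteq> k \<Longrightarrow> pt t' k l \<notin> M"
  shows False
proof -
  interpret junction n t t' i k w by fact
  obtain j m where jm: "j \<noteq> i" "m \<noteq> i" "j \<noteq> m" by (rule two_other_corners)
  obtain l where l: "l \<noteq> k" by (rule other_corner)
  \<comment> \<open>\<open>?r\<close> is the midpoint of its block opposite to \<open>w\<close>, and
    \<open>?p\<close> is a midpoint next to \<open>w\<close> in the other block.\<close>
  let ?r = "pt t j m" and ?p = "pt t' k l"
  have arcs: "(?r, pt t i j) \<in> parcs (gasket (Suc n))" "(pt t i j, w) \<in> parcs (gasket (Suc n))"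
    "(w, ?p) \<in> parcs (gasket (Suc n))"
    using pt_arc[OF t, of m i j] pt_arc[OF t, of j i i] pt_arc[OF t', of k l k] jm l w w'
    by (auto simp: pt_commute[of t i j])
  have w_ne: "w \<noteq> ?r" "w \<noteq> ?p" using mid_eq_pt jm l w w' by metis+
  have r: "?r \<in> M"
  proof (rule ccontr)
    assume r: "?r \<notin> M"
    have ne: "?r \<noteq> ?p" using mid_eq_pt neq jm by metis
    have "walk G ?r [?r, pt t i j, w, ?p] ?p"
      using arcs arc_verts by (auto simp: walk_iff)
    moreover have "visible G M ?r ?p"
      using r assms(4)[OF l] ne by (intro visible_same pt_vert t t') auto
    ultimately obtain p where p: "walk G ?r p ?p" "length p \<le> length [?r, pt t i j, w, ?p]"
      "set p \<inter> (M - {?r, ?p}) = {}" using visibleD by metis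
    \<comment> \<open>Visibility gives a walk with at most three edges that avoids \<open>w\<close>.
      One, two and three edges are excluded by \<open>no_arc\<close>, \<open>no_two\<close> and
      \<open>three_walk\<close>.\<close>
    then have "w \<notin> set p" using assms(2) w_ne by blast
    have no_arc: "(?r, ?p) \<notin> parcs (gasket (Suc n))"
      using mid_arc_block[of t j m ?p n] mid_eq_pt neq jm l by metis
    have no_two: "(x, ?p) \<notin> parcs (gasket (Suc n))" if "(?r, x) \<in> parcs (gasket (Suc n))" "x \<noteq> w" for x
      using mid_arc_block[OF that(1) jm(3)] mid_arc_block[OF symD[OF sym_gasket, of x ?p] not_sym[OF l]]
        block_inter that(2) by metis
    from p(1,2) ne no_arc \<open>w \<notin> set p\<close> no_two three_walk[OF jm(3) l] show False
      by (cases p rule: vwalk_arcs.cases; cases "tl (tl p)"; cases "tl (tl (tl p))";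
          cases "tl (tl (tl (tl p)))") (auto simp: walk_iff)
  qed
  have "(?r, w) \<notin> parcs (gasket (Suc n))"
    using corner_arc_block[OF symD[OF sym_gasket, of ?r w, unfolded w]] mid_eq_pt jm w by metis
  then obtain x where x: "(?r, x) \<in> parcs (gasket (Suc n))" "(x, w) \<in> parcs (gasket (Suc n))"
    "x \<notin> M - {?r, w}"
    using same_common_neighbour[of ?r w "pt t i j"] arcs w_ne r assms(2) by metis
  \<comment> \<open>A common neighbour of \<open>?r\<close> and \<open>w\<close> has to be a
    midpoint of the block of \<open>t\<close> next to \<open>w\<close>, and all of these are in
    \<open>M\<close>.\<close>
  obtain a b where "x = pt t a b" using mid_arc_block[OF x(1) jm(3)] .
  then obtain j' where j': "j' \<noteq> i" "x = pt t i j'"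
    using corner_arc_block symD[OF sym_gasket x(2)] w by metis
  have "x \<noteq> ?r" "x \<noteq> w" using mid_eq_pt j' jm w by metis+
  with x(3) assms(3)[OF j'(1)] j'(2) show False by blast
qed

text \<open>By \<open>junction_separates\<close>, membership in \<open>M\<close> is constant on the
  midpoints next to \<open>w\<close> within each block and opposite across \<open>w\<close>. The two
  cases differ by exchanging the blocks.\<close>

lemma junction_not_in:
  assumes "junction n t t' i k w"
  shows "w \<notin> M"
proof
  assume inM: "w \<in> M"
  interpret junction n t t' i k w by fact
  have sym: "junction n t' t k i w"
    using t t' neq w w' by unfold_locales auto
  obtain j where j: "j \<noteq> i" by (rule other_corner)
  obtain l where l: "l \<noteq> k" by (rule other_corner)
  note sep = junction_separates[OF assms inM]
  show False
  proof (cases "pt t i j \<in> M")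
    case True
    then have "\<And>l. l \<noteq> k \<Longrightarrow> pt t' k l \<notin> M" "\<And>j. j \<noteq> i \<Longrightarrow> pt t i j \<in> M"
      using sep[OF j] sep[OF _ l] sep[OF j l] by blast+
    then show False using junction_one_sided[OF assms inM] by blast
  next
    case False
    then have "\<And>l. l \<noteq> k \<Longrightarrow> pt t' k l \<in> M" "\<And>j. j \<noteq> i \<Longrightarrow> pt t i j \<notin> M"
      using sep[OF j] sep[OF _ l] sep[OF j l] by blast+
    then show False using junction_one_sided[OF sym inM] by blast
  qed
qed

lemma corner_in_set:
  assumes "t \<in> tri n" "pt t i i \<in> M"
  shows "pt t i i = corner_pt (Suc n) i"
  using tri_junction[OF assms(1), of i]
proof (elim disjE bexE exE conjE)
  assume "(\<lambda>k. t k + delta i k) = corner_pt n i"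
  then have e: "t k + delta i k = corner_pt n i k" for k by (simp add: fun_eq_iff)
  have "pt t i i k = 2 * (t k + delta i k)" for k by (simp add: pt_def)
  then have "pt t i i k = corner_pt (Suc n) i k" for k
    unfolding e by (simp add: corner_pt_def)
  then show ?thesis by blast
next
  fix t' c assume t': "t' \<in> tri n" "t' \<noteq> t" "(\<lambda>k. t k + delta i k) = (\<lambda>k. t' k + delta c k)"
  have "pt t i i k = pt t' c c k" for k
    using fun_cong[OF t'(3), of k] by (simp add: pt_def)
  then have "pt t i i = pt t' c c" by blast
  then have "junction n t t' i c (pt t i i)"
    using assms(1) t' by unfold_locales auto
  then show ?thesis using junction_not_in assms(2) by blast
qed

lemma mid_in_set:
  assumes "t \<in> tri n" "i \<noteq> j" "pt t i j \<in> M"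
  shows "pt t i i \<in> M \<or> pt t j j \<in> M"
proof (rule ccontr)
  assume not: "\<not> ?thesis"
  have ne: "pt t i i \<noteq> pt t j j" using corner_eq_pt_same assms(2) by metis
  have no_arc: "(pt t i i, pt t j j) \<notin> parcs (gasket (Suc n))"
    using corner_arc_block corner_eq_pt_same assms(2) by metis
  obtain x where "(pt t i i, x) \<in> parcs (gasket (Suc n))" "(x, pt t j j) \<in> parcs (gasket (Suc n))"
    "x \<notin> M - {pt t i i, pt t j j}"
    using same_common_neighbour[OF ne _ no_arc, of "pt t i j"] not
      pt_arc[OF assms(1), of i j i] pt_arc[OF assms(1), of i j j] assms(2)
    by (auto simp: pt_commute)
  moreover from this have "x = pt t i j" using corners_common_neighbour assms(2) by metis
  ultimately show False using assms(3) not by auto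
qed

section \<open>Counting by the extreme vertices in \<open>M\<close>\<close>

definition corners :: "corner set" where
  "corners = {a. corner_pt (Suc n) a \<in> M}"

lemma near_corners:
  assumes "a \<in> corners" "b \<in> corners" "a \<noteq> b"
  shows "near (Suc n) a b \<notin> M"
proof (rule visible_corners_near)
  show "visible G M (corner_pt (Suc n) a) (corner_pt (Suc n) b)"
    using assms by (intro visible_same corner_pt_vert) (auto simp: corners_def corner_pt_eq_iff)
qed (use assms in auto)

lemma subset_near:
  "M \<subseteq> (\<Union>a\<in>corners. insert (corner_pt (Suc n) a) (near (Suc n) a ` (- corners)))"
proof
  fix x assume x: "x \<in> M"
  obtain t i j where t: "t \<in> tri n" "x = pt t i j"
    using x subset vert_Suc_iff by blast
  \<comment> \<open>The indices are bound anew because either end of the side may be the one in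
    \<open>M\<close>.\<close>
  have mid: "x \<in> (\<Union>a\<in>corners. near (Suc n) a ` (- corners))"
    if x': "x = pt t i j" "i \<noteq> j" "pt t i i \<in> M" for i j
  proof -
    have c: "pt t i i = corner_pt (Suc n) i" using corner_in_set t(1) x'(3) .
    then have i: "i \<in> corners" using x'(3) by (simp add: corners_def)
    have "x k = near (Suc n) i j k" for k
      using fun_cong[OF c, of k] by (auto simp: x'(1) pt_def corner_pt_def near_def delta_def)
    then have "x = near (Suc n) i j" by blast
    moreover from this x have "j \<notin> corners" using near_corners i x'(2) by blast
    ultimately show ?thesis using i by blast
  qed
  show "x \<in> (\<Union>a\<in>corners. insert (corner_pt (Suc n) a) (near (Suc n) a ` (- corners)))"
  proof (cases "i = j")
    case True
    then have "x = corner_pt (Suc n) i" using corner_in_set t x by simp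
    then show ?thesis using x by (auto simp: corners_def)
  next
    case False
    then consider "pt t i i \<in> M" | "pt t j j \<in> M" using mid_in_set t x by blast
    then show ?thesis
      using mid[OF t(2) False] mid[OF t(2)[unfolded pt_commute[of t i]] not_sym[OF False]] by cases auto
  qed
qed

lemma finite_corner: "finite (A :: corner set)"
  by (rule finite_subset[of _ "{TopC, LeftC, RightC}"]) (use corner.exhaust in auto)

text \<open>If \<open>s\<close> extreme vertices are in \<open>M\<close>, each accounts for itself
  and at most \<open>3 - s\<close> neighbours, one towards each extreme vertex outside
  \<open>M\<close>.\<close>

lemma card_le_corners: "card M \<le> card corners * (4 - card corners)" "card corners \<le> 3"
proof -
  have U: "card (UNIV :: corner set) = 3" by (simp add: UNIV_corner)
  have "card corners \<le> card (UNIV :: corner set)" by (rule card_mono) (auto simp: finite_corner)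
  with U show le: "card corners \<le> 3" by simp
  have "card (insert (corner_pt (Suc n) a) (near (Suc n) a ` (- corners))) \<le> 4 - card corners" for a
  proof -
    have "card (insert (corner_pt (Suc n) a) (near (Suc n) a ` (- corners))) \<le>
        Suc (card (near (Suc n) a ` (- corners)))" by (rule card_insert_le_m1) simp_all
    also have "\<dots> \<le> Suc (card (- corners))" by (simp add: card_image_le finite_corner)
    also have "card (- corners) = 3 - card corners"
      using U card_Diff_subset[of corners UNIV] finite_corner by (simp add: Compl_eq_Diff_UNIV)
    finally show ?thesis using le by simp
  qed
  then have "card (\<Union>a\<in>corners. insert (corner_pt (Suc n) a) (near (Suc n) a ` (- corners))) \<le>
      (\<Sum>a\<in>corners. 4 - card corners)"
    by (intro order_trans[OF card_UN_le] sum_mono finite_corner)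
  moreover have "card M \<le> card (\<Union>a\<in>corners. insert (corner_pt (Suc n) a) (near (Suc n) a ` (- corners)))"
    by (intro card_mono subset_near finite_UN_I finite_corner) (simp add: finite_corner)
  ultimately show "card M \<le> card corners * (4 - card corners)" by simp
qed

lemma card_le_4: "card M \<le> 4"
proof -
  have "card corners \<in> {0, 1, 2, 3}" using card_le_corners(2) by auto
  with card_le_corners(1) show ?thesis by auto
qed

end

text \<open>Only two extreme vertices \<open>a\<close>, \<open>b\<close> in \<open>M\<close> could
  give 4. On level 1 the third extreme vertex \<open>d\<close> and the midpoint between
  \<open>a\<close> and \<open>b\<close> are then outside \<open>M\<close>, and their only common
  neighbours are the other two midpoints, which therefore cannot both be in
  \<open>M\<close>.\<close>

lemma (in dual_set) card_le_3:
  assumes "n = 0"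
  shows "card M \<le> 3"
proof -
  have t0: "(\<lambda>_. 0) \<in> tri n" "\<And>t. t \<in> tri n \<Longrightarrow> t = (\<lambda>_. 0)" using assms by auto
  have c: "corner_pt (Suc n) a = pt (\<lambda>_. 0) a a" for a
    using assms by (simp add: corner_pt_def pt_def fun_eq_iff)
  have nr: "near (Suc n) a b = pt (\<lambda>_. 0) a b" for a b
    using assms by (simp add: near_def pt_def fun_eq_iff)
  show ?thesis
  proof (cases "card corners = 2")
    case False
    then have "card corners \<in> {0, 1, 3}" using card_le_corners(2) by auto
    with card_le_corners(1) show ?thesis by auto
  next
    case True
    then obtain a b where ab: "corners = {a, b}" "a \<noteq> b" by (meson card_2_iff)
    obtain d where d: "d \<noteq> a" "d \<noteq> b" by (metis corner.distinct)
    have compl: "- corners = {d}"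
      using ab d by (cases a; cases b; cases d) (auto intro: corner.exhaust)
    have not_both: "\<not> (near (Suc n) a d \<in> M \<and> near (Suc n) b d \<in> M)"
    proof
      assume both: "near (Suc n) a d \<in> M \<and> near (Suc n) b d \<in> M"
      have D: "corner_pt (Suc n) d \<notin> M" using compl by (auto simp: corners_def)
      have AB: "near (Suc n) a b \<notin> M" using near_corners ab by simp
      have ne: "corner_pt (Suc n) d \<noteq> near (Suc n) a b"
        using near_ne_corner_pt[of "Suc n" b a d] ab(2) by simp
      have no_arc: "(corner_pt (Suc n) d, near (Suc n) a b) \<notin> parcs (gasket (Suc n))"
        unfolding c nr by (metis ab(2) corner_arc_block d mid_eq_pt)
      have arcs: "(corner_pt (Suc n) d, near (Suc n) a d) \<in> parcs (gasket (Suc n))"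
        "(near (Suc n) a d, near (Suc n) a b) \<in> parcs (gasket (Suc n))"
        using pt_arc[OF t0(1), of d a d] pt_arc[OF t0(1), of d b a] d unfolding c nr
        by (auto simp: pt_commute)
      obtain x where x: "(corner_pt (Suc n) d, x) \<in> parcs (gasket (Suc n))"
        "x \<notin> M - {corner_pt (Suc n) d, near (Suc n) a b}" "(x, near (Suc n) a b) \<in> parcs (gasket (Suc n))"
        using same_common_neighbour[OF ne _ no_arc arcs] D AB by blast
      obtain s k l where "s \<in> tri n" "x = pt s k l"
        using x(1) arc_verts vert_Suc_iff by blast
      then have "x = pt (\<lambda>_. 0) k l" using t0(2) by blast
      then obtain j where "j \<noteq> d" "x = pt (\<lambda>_. 0) d j"
        using corner_arc_block x(1) unfolding c by metis
      moreover from this have "j = a \<or> j = b" using compl ab by blast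
      ultimately have "x = near (Suc n) a d \<or> x = near (Suc n) b d"
        unfolding nr using pt_commute by metis
      then have "x \<in> M" using both by blast
      moreover have "x \<noteq> corner_pt (Suc n) d" using \<open>x \<in> M\<close> D by blast
      moreover have "x \<noteq> near (Suc n) a b" using \<open>x \<in> M\<close> AB by blast
      ultimately show False using x(2) by blast
    qed
    have "M \<subseteq> {corner_pt (Suc n) a, corner_pt (Suc n) b, near (Suc n) a d, near (Suc n) b d}"
      using subset_near unfolding compl unfolding ab(1) by auto
    then have "M \<subseteq> {corner_pt (Suc n) a, corner_pt (Suc n) b, near (Suc n) a d} \<or>
        M \<subseteq> {corner_pt (Suc n) a, corner_pt (Suc n) b, near (Suc n) b d}"
      using not_both by blast
    moreover have "card {x, y, z} \<le> 3" for x y z :: "corner \<Rightarrow> nat"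
      by (simp add: card_insert_if)
    ultimately show ?thesis
      by (meson card_mono finite.emptyI finite.insertI order_trans)
  qed
qed

section \<open>The lower bound\<close>

lemma finite_pverts_gasket: "finite (pverts (gasket n))"
proof -
  interpret pair_graph "ST n" by (rule pair_graph_ST)
  show ?thesis unfolding pos_image_pverts[symmetric] using pair_finite_verts by simp
qed

lemma mu_d_eqI:
  assumes "dual_mutual_visibility_set (with_proj (gasket n)) M" "card M = m"
    and "\<And>M. dual_mutual_visibility_set (with_proj (gasket n)) M \<Longrightarrow> card M \<le> m"
  shows "mu_d (with_proj (gasket n)) = m"
proof -
  have "finite {M. dual_mutual_visibility_set (with_proj (gasket n)) M}"
    by (rule finite_subset[of _ "Pow (pverts (gasket n))"])
      (auto simp: dual_mutual_visibility_set_def finite_pverts_gasket)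
  with assms show ?thesis unfolding mu_d_def by (intro Max_eqI) auto
qed

text \<open>Two extreme vertices see each other through the midpoint between them, and the three
  remaining vertices are pairwise adjacent.\<close>

lemma corner_pts_dual: "dual_mutual_visibility_set (with_proj (gasket (Suc 0))) (range (corner_pt (Suc 0)))"
proof -
  let ?M = "range (corner_pt (Suc 0))" and ?o = "\<lambda>_. 0 :: nat" and ?G = "with_proj (gasket (Suc 0))"
  have t: "?o \<in> tri 0" by simp
  have c: "corner_pt (Suc 0) a = pt ?o a a" for a by (simp add: corner_pt_def pt_def fun_eq_iff)
  have M: "visible ?G ?M (corner_pt (Suc 0) a) (corner_pt (Suc 0) b)" if "a \<noteq> b" for a b
  proof (rule visibleI)
    show "walk ?G (corner_pt (Suc 0) a) [corner_pt (Suc 0) a, pt ?o a b, corner_pt (Suc 0) b] (corner_pt (Suc 0) b)"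
      unfolding c using pt_arc[OF t, of a b a] pt_arc[OF t, of a b b] pt_vert[OF t] that
      by (auto simp: walk_iff pt_commute)
    show "length [corner_pt (Suc 0) a, pt ?o a b, corner_pt (Suc 0) b] \<le> length q"
      if "walk ?G (corner_pt (Suc 0) a) q (corner_pt (Suc 0) b)" for q
      using walk_coordinate(1)[OF that, of a] \<open>a \<noteq> b\<close> by (simp add: corner_pt_def delta_def)
    have "pt ?o a b \<notin> ?M" using mid_eq_pt that unfolding c by blast
    then show "set [corner_pt (Suc 0) a, pt ?o a b, corner_pt (Suc 0) b] \<inter>
        (?M - {corner_pt (Suc 0) a, corner_pt (Suc 0) b}) = {}" by auto
  qed
  have N: "visible ?G ?M u v" if uv: "u \<in> pverts (gasket (Suc 0)) - ?M" "v \<in> pverts (gasket (Suc 0)) - ?M" "u \<noteq> v" for u v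
  proof -
    have "u \<in> pverts (gasket (Suc 0))" "v \<in> pverts (gasket (Suc 0))" using uv(1,2) by blast+
    then obtain s s' i j k l where "s \<in> tri 0" "u = pt s i j" "s' \<in> tri 0" "v = pt s' k l"
      unfolding vert_Suc_iff by blast
    then have u: "u = pt ?o i j" and v: "v = pt ?o k l" by simp_all
    have "i \<noteq> j" "k \<noteq> l" using uv(1,2) unfolding c u v by auto
    then
    have "i = k \<and> j \<noteq> l \<or> i = l \<and> j \<noteq> k \<or> j = k \<and> i \<noteq> l \<or> j = l \<and> i \<noteq> k"
      using u v uv(3) pt_commute[of ?o i j] by (cases i; cases j; cases k; cases l) auto
    then have "(u, v) \<in> parcs (gasket (Suc 0))"
      using u v pt_arc[OF t] pt_commute by metis
    then show ?thesis using uv by (intro visible_arc) auto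
  qed
  show ?thesis
    unfolding dual_mutual_visibility_set_def using M N corner_pt_vert by (auto simp: corner_pt_eq_iff)
qed

text \<open>Every vertex reaches every extreme vertex: inside its copy \<open>d\<close> it reaches
  the point shared with copy \<open>c\<close>, and from there the extreme vertex
  \<open>c\<close>.\<close>

lemma gasket_connected:
  assumes "u \<in> pverts (gasket n)" "v \<in> pverts (gasket n)"
  shows "(u, v) \<in> (parcs (gasket n))\<^sup>*"
proof -
  have sym: "(y, x) \<in> (parcs (gasket n))\<^sup>*" if "(x, y) \<in> (parcs (gasket n))\<^sup>*" for x y n
    using that sym_rtrancl[OF sym_gasket[of n]] by (blast dest: symD)
  have "(x, corner_pt n c) \<in> (parcs (gasket n))\<^sup>*" if "x \<in> pverts (gasket n)" for x c
    using that
  proof (induction n arbitrary: x c)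
    case 0
    then obtain i where "x = (\<lambda>k. 0 + delta i k)" by (auto simp: pverts_gasket)
    moreover have "corner_pt 0 c = (\<lambda>k. 0 + delta c k)" by (simp add: corner_pt_def fun_eq_iff)
    ultimately have "x = corner_pt 0 c \<or> (x, corner_pt 0 c) \<in> parcs (gasket 0)"
      unfolding arc_iff by auto
    then show ?case by auto
  next
    case (Suc n)
    have shift: "(shift n d y, shift n d z) \<in> (parcs (gasket (Suc n)))\<^sup>*"
      if "(y, z) \<in> (parcs (gasket n))\<^sup>*" for d y z
      using that
    proof (induction rule: rtrancl_induct)
      case (step y' z')
      have "(shift n d y', shift n d z') \<in> parcs (gasket (Suc n))"
        unfolding parcs_gasket_Suc using step.hyps(2) by (blast intro: map_prod_imageI)
      with step.IH show ?case by (rule rtrancl_into_rtrancl)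
    qed simp
    obtain d y where y: "y \<in> pverts (gasket n)" "x = shift n d y"
      using Suc.prems unfolding pverts_gasket_Suc by blast
    have 1: "(x, shift n d (corner_pt n c)) \<in> (parcs (gasket (Suc n)))\<^sup>*"
      unfolding y(2) by (rule shift[OF Suc.IH[OF y(1)]])
    have comm: "shift n d (corner_pt n c) = shift n c (corner_pt n d)"
      by (simp add: shift_def corner_pt_def fun_eq_iff)
    have 2: "(shift n c (corner_pt n d), shift n c (corner_pt n c)) \<in> (parcs (gasket (Suc n)))\<^sup>*"
      by (rule shift[OF Suc.IH[OF corner_pt_vert]])
    have "shift n c (corner_pt n c) = corner_pt (Suc n) c"
      by (simp add: shift_def corner_pt_def fun_eq_iff)
    with 1 2 comm show ?case by (metis rtrancl_trans)
  qed
  from this[OF assms(1)] sym[OF this[OF assms(2)]] show ?thesis by (metis rtrancl_trans)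
qed

lemma gasket_shortest_vpath:
  assumes "u \<in> pverts (gasket n)" "v \<in> pverts (gasket n)"
  obtains p where "shortest_vpath (with_proj (gasket n)) u p v"
proof -
  have "\<exists>p. walk (with_proj (gasket n)) u p v"
    using gasket_connected[OF assms]
  proof (induction rule: converse_rtrancl_induct)
    case base
    have "walk (with_proj (gasket n)) v [v] v" using assms(2) by (simp add: walk_iff)
    then show ?case ..
  next
    case (step y z)
    then obtain p where p: "walk (with_proj (gasket n)) z p v" by blast
    then have "walk (with_proj (gasket n)) y (y # p) v"
      using step.hyps(1) arc_verts[OF step.hyps(1)] by (auto simp: walk_iff successively_Cons)
    then show ?case ..
  qed
  then show thesis using shortest_vpath_exists that by metis
qed

lemma near_eq_pt: "near (Suc n) a b = pt (\<lambda>k. (2 ^ n - 1) * delta a k) a b"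
  and corner_pt_eq_pt: "corner_pt (Suc n) a = pt (\<lambda>k. (2 ^ n - 1) * delta a k) a a"
proof -
  obtain m where "(2::nat) ^ n = Suc m" using not0_implies_Suc[of "2 ^ n"] by auto
  then show "near (Suc n) a b = pt (\<lambda>k. (2 ^ n - 1) * delta a k) a b"
    "corner_pt (Suc n) a = pt (\<lambda>k. (2 ^ n - 1) * delta a k) a a"
    by (auto simp: near_def corner_pt_def pt_def delta_def fun_eq_iff)
qed

lemma corner_tri: "(\<lambda>k. (2 ^ n - 1) * delta a k) \<in> tri n"
  using side_in_tri[of "2 ^ n - 1" 0 n a a] by simp

text \<open>The two neighbours of an extreme vertex are adjacent, so passing through it would waste
  a step.\<close>

lemma corner_pt_not_interior:
  assumes "shortest_vpath (with_proj (gasket (Suc n))) u p v" "corner_pt (Suc n) a \<in> set p"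
  shows "corner_pt (Suc n) a = u \<or> corner_pt (Suc n) a = v"
proof (rule ccontr)
  assume "\<not> ?thesis"
  then have "corner_pt (Suc n) a \<noteq> u" "corner_pt (Suc n) a \<noteq> v" by auto
  from shortest_vpath_interior[OF assms this] obtain x y
    where xy: "(x, corner_pt (Suc n) a) \<in> parcs (gasket (Suc n))"
      "(corner_pt (Suc n) a, y) \<in> parcs (gasket (Suc n))" "x \<noteq> y" "(x, y) \<notin> parcs (gasket (Suc n))"
    by (metis with_proj_simps(3))
  obtain b where "b \<noteq> a" "x = near (Suc n) a b" using corner_pt_arc symD[OF sym_gasket xy(1)] by metis
  moreover obtain c where "c \<noteq> a" "y = near (Suc n) a c" using corner_pt_arc xy(2) by metis
  ultimately show False
    using xy(3,4) pt_arc[OF corner_tri, of b c n a a] unfolding near_eq_pt by metis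
qed

text \<open>For distinct corners and positive level this is the midpoint opposite to
  \<open>a\<close> in the block at the extreme vertex \<open>a\<close>.\<close>

definition far :: "nat \<Rightarrow> corner \<Rightarrow> corner \<Rightarrow> corner \<Rightarrow> corner \<Rightarrow> nat" where
  "far n a b c = (\<lambda>k. (2 ^ n - 2) * delta a k + delta b k + delta c k)"

lemma far_eq_pt: "far (Suc n) a b c = pt (\<lambda>k. (2 ^ n - 1) * delta a k) b c"
  by (simp add: far_def pt_def fun_eq_iff diff_mult_distrib2)

text \<open>
  A shortest path through \<open>near n a c\<close> that avoids the corner \<open>a\<close> can use \<open>far n a b c\<close> instead.
\<close>

lemma near_detour:
  assumes abc: "a \<noteq> b" "a \<noteq> c" "b \<noteq> c"
    and xz: "(x, near (Suc n) a c) \<in> parcs (gasket (Suc n))" "(near (Suc n) a c, y) \<in> parcs (gasket (Suc n))"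
    and xy: "x \<noteq> y" "(x, y) \<notin> parcs (gasket (Suc n))"
    and A: "x \<noteq> corner_pt (Suc n) a" "y \<noteq> corner_pt (Suc n) a"
  shows "(x, far (Suc n) a b c) \<in> parcs (gasket (Suc n)) \<and> (far (Suc n) a b c, y) \<in> parcs (gasket (Suc n))"
proof -
  define t where "t = (\<lambda>k. (2 ^ n - 1) * delta a k)"
  have t: "t \<in> tri n" unfolding t_def by (rule corner_tri)
  note arc = pt_arc[OF t]
  have nbr: "z = pt t a b \<or> z = pt t c b \<or> z = pt t c c"
    if z: "(pt t a c, z) \<in> parcs (gasket (Suc n))" "z \<noteq> pt t a a" for z
  proof -
    have corner: "e = a \<or> e = b \<or> e = c" for e
      using abc by (cases a; cases b; cases c; cases e) auto
    show ?thesis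
      using z(1) abc(2)
    proof (cases rule: mid_arc)
      case (1 e)
      with z(2) corner[of e] show ?thesis by auto
    next
      case (2 e)
      with corner[of e] show ?thesis by auto
    qed
  qed
  have "(pt t a c, x) \<in> parcs (gasket (Suc n))" "(pt t a c, y) \<in> parcs (gasket (Suc n))"
    "x \<noteq> pt t a a" "y \<noteq> pt t a a"
    using xz(2) A symD[OF sym_gasket xz(1)] unfolding near_eq_pt corner_pt_eq_pt t_def by blast+
  then have x: "x = pt t a b \<or> x = pt t c b \<or> x = pt t c c"
    and y: "y = pt t a b \<or> y = pt t c b \<or> y = pt t c c" using nbr by blast+
  have "(pt t a b, pt t c b) \<in> parcs (gasket (Suc n))" "(pt t c b, pt t a b) \<in> parcs (gasket (Suc n))"
    "(pt t c c, pt t c b) \<in> parcs (gasket (Suc n))" "(pt t c b, pt t c c) \<in> parcs (gasket (Suc n))"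
    using arc[of a c b] arc[of c a b] arc[of c b c] arc[of b c c] abc by (auto simp: pt_commute)
  then show ?thesis
    using x y xy unfolding far_eq_pt t_def[symmetric] pt_commute[of t b c] by metis
qed

definition witness :: "nat \<Rightarrow> corner \<Rightarrow> corner \<Rightarrow> corner \<Rightarrow> (corner \<Rightarrow> nat) set" where
  "witness n a b c = {corner_pt n a, corner_pt n b, near n a c, near n b c}"

lemma witness_commute: "witness n a b c = witness n b a c"
  by (auto simp: witness_def)

section \<open>The four-element witness from level 2 on\<close>

locale three_corners =
  fixes n :: nat and a b c :: corner
  assumes ab: "a \<noteq> b" and ac: "a \<noteq> c" and bc: "b \<noteq> c"
begin

abbreviation "N \<equiv> Suc (Suc n)"
abbreviation "G \<equiv> with_proj (gasket N)"
abbreviation "W \<equiv> witness N a b c"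

lemma two_power: "(2::nat) ^ N \<ge> 4"
  using self_le_power[of "2::nat" "Suc n"] by (simp add: numeral_eq_Suc)

lemma near_vert: "near N d e \<in> pverts (gasket N)"
  unfolding near_eq_pt by (rule pt_vert[OF corner_tri])

lemma far_vert: "far N a b c \<in> pverts (gasket N)"
  unfolding far_eq_pt by (rule pt_vert[OF corner_tri])

text \<open>On level 1 this point would coincide with the witness element \<open>near n b c\<close>;
  from level 2 on the blocks at \<open>a\<close> and \<open>b\<close> are different.\<close>

lemma far_notin: "far N a b c \<notin> W"
proof -
  have "2 ^ N - 2 \<ge> (2::nat)" "2 ^ N - (1::nat) \<ge> 2" using two_power by linarith+
  then have "far N a b c b = 1" "far N a b c a \<ge> 2" "near N a c b = 0" "near N b c a = 0"
    "corner_pt N a b = 0" "corner_pt N b a = 0"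
    using ab ac bc by (auto simp: far_def near_def corner_pt_def delta_def)
  then show ?thesis unfolding witness_def by auto
qed

text \<open>Any shortest path between vertices outside \<open>W\<close> avoids the extreme vertices
  in \<open>W\<close>, which are never interior. Two exchanges then replace the near points by far
  points.\<close>

lemma visible_complement:
  assumes u: "u \<in> pverts (gasket N) - W" and v: "v \<in> pverts (gasket N) - W"
  shows "visible G W u v"
proof -
  obtain p where p: "shortest_vpath G u p v" using gasket_shortest_vpath u v by blast
  have A: "corner_pt N a \<notin> set q" and B: "corner_pt N b \<notin> set q" if "shortest_vpath G u q v" for q
    using corner_pt_not_interior[OF that] u v by (auto simp: witness_def)
  have ne: "near N a c \<noteq> u" "near N a c \<noteq> v" "near N b c \<noteq> u" "near N b c \<noteq> v"
    using u v by (auto simp: witness_def)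
  obtain q where q: "shortest_vpath G u q v" "set q \<subseteq> insert (far N a b c) (set p - {near N a c})"
  proof (rule shortest_vpath_replace[OF p ne(1,2)])
    show "far N a b c \<in> verts G" using far_vert by simp
    show "(x, far N a b c) \<in> arcs_ends G \<and> (far N a b c, y) \<in> arcs_ends G"
      if "x \<in> set p" "y \<in> set p" "(x, near N a c) \<in> arcs_ends G" "(near N a c, y) \<in> arcs_ends G"
        "x \<noteq> y" "(x, y) \<notin> arcs_ends G" for x y
      using near_detour[OF ab ac bc, of x "Suc n" y] that A[OF p] by auto
  qed
  interpret swap: three_corners n b a c using ab ac bc by unfold_locales auto
  obtain r where r: "shortest_vpath G u r v" "set r \<subseteq> insert (far N b a c) (set q - {near N b c})"
  proof (rule shortest_vpath_replace[OF q(1) ne(3,4)])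
    show "far N b a c \<in> verts G" using swap.far_vert by simp
    show "(x, far N b a c) \<in> arcs_ends G \<and> (far N b a c, y) \<in> arcs_ends G"
      if "x \<in> set q" "y \<in> set q" "(x, near N b c) \<in> arcs_ends G" "(near N b c, y) \<in> arcs_ends G"
        "x \<noteq> y" "(x, y) \<notin> arcs_ends G" for x y
      using near_detour[OF ab[symmetric] bc ac, of x "Suc n" y] that B[OF q(1)] by auto
  qed
  have "far N a b c \<notin> {near N a c, near N b c}" "far N b a c \<notin> {near N a c, near N b c}"
    using far_notin swap.far_notin by (simp_all add: witness_def)
  then have "near N a c \<notin> set r" "near N b c \<notin> set r"
    using subsetD[OF q(2), of "near N a c"] subsetD[OF r(2), of "near N a c"]
      subsetD[OF r(2), of "near N b c"] by auto
  then have "set r \<inter> W = {}" using A[OF r(1)] B[OF r(1)] by (auto simp: witness_def)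
  with r(1) show ?thesis unfolding visible_def by blast
qed

lemma visible_corner_near: "visible G W (corner_pt N a) (near N a c)"
proof (rule visible_arc)
  show "(corner_pt N a, near N a c) \<in> arcs_ends G"
    using pt_arc[OF corner_tri, of a c "Suc n" a a] ac by (simp add: near_eq_pt corner_pt_eq_pt)
  show "corner_pt N a \<noteq> near N a c" using near_ne_corner_pt[of N c a a] ac by auto
qed (use corner_pt_vert near_vert in auto)

lemma side_notin: "side N a b m \<notin> {near N a c, near N b c}"
proof -
  have "side N a b m c = 0" "near N a c c = 1" "near N b c c = 1"
    using ac bc by (simp_all add: side_def near_def delta_def)
  then show ?thesis by auto
qed

text \<open>The side is shortest because the \<open>a\<close>-coordinate has to drop from
  \<open>2 ^ N\<close> to 0. It misses both near points, as its \<open>c\<close>-coordinate is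
  always 0.\<close>

lemma visible_corners: "visible G W (corner_pt N a) (corner_pt N b)"
proof (rule visibleI)
  show "walk G (corner_pt N a) (map (side N a b) [0..<Suc (2 ^ N)]) (corner_pt N b)"
    using side_walk[OF order_refl ab, of N] unfolding side_max .
  show "length (map (side N a b) [0..<Suc (2 ^ N)]) \<le> length q"
    if "walk G (corner_pt N a) q (corner_pt N b)" for q
    using walk_coordinate(1)[OF that, of a] ab by (simp add: corner_pt_def delta_def)
  show "set (map (side N a b) [0..<Suc (2 ^ N)]) \<inter> (W - {corner_pt N a, corner_pt N b}) = {}"
    using side_notin by (auto simp: witness_def)
qed

lemma visible_corner_other_near: "visible G W (corner_pt N a) (near N b c)"
proof (rule visibleI)
  \<comment> \<open>This follows the side from \<open>a\<close> and stops one step before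
    \<open>b\<close>, at \<open>near N b a\<close>, which is adjacent to
    \<open>near N b c\<close>.\<close>
  define p where "p = map (side N a b) [0..<Suc (2 ^ N - 1)]"
  have w: "walk G (corner_pt N a) p (side N a b (2 ^ N - 1))"
    unfolding p_def by (rule side_walk) (use ab in auto)
  have "side N a b (2 ^ N - 1) = near N b a"
    by (simp add: side_def near_def fun_eq_iff)
  then have "(side N a b (2 ^ N - 1), near N b c) \<in> parcs (gasket N)"
    using pt_arc[OF corner_tri, of a c "Suc n" b b] ac by (simp add: near_eq_pt)
  with w show "walk G (corner_pt N a) (p @ [near N b c]) (near N b c)"
    using near_vert by (auto simp: walk_iff successively_append_iff)
  show "length (p @ [near N b c]) \<le> length q" if "walk G (corner_pt N a) q (near N b c)" for q
    using walk_coordinate(1)[OF that, of a] ab ac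
    by (simp add: corner_pt_def near_def delta_def p_def)
  have "side N a b m \<noteq> corner_pt N b" if "m < 2 ^ N" for m
  proof
    assume "side N a b m = corner_pt N b"
    from fun_cong[OF this, of a] ab that show False
      by (simp add: side_def corner_pt_def delta_def)
  qed
  moreover have "set p = side N a b ` {..<2 ^ N}"
    by (simp add: p_def atLeast0LessThan del: upt_Suc)
  ultimately have "corner_pt N b \<notin> set p" "near N a c \<notin> set p" using side_notin by fastforce+
  then show "set (p @ [near N b c]) \<inter> (W - {corner_pt N a, near N b c}) = {}"
    by (auto simp: witness_def)
qed

text \<open>The other elements of \<open>W\<close> are extreme vertices and hence never interior, so
  any shortest path serves.\<close>

lemma visible_nears: "visible G W (near N a c) (near N b c)"
proof -
  obtain p where p: "shortest_vpath G (near N a c) p (near N b c)"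
    using gasket_shortest_vpath near_vert by blast
  have "corner_pt N d \<notin> set p" for d
    using corner_pt_not_interior[OF p] near_ne_corner_pt ac bc by (metis zero_less_Suc)
  then have "set p \<inter> (W - {near N a c, near N b c}) = {}" by (auto simp: witness_def)
  with p show ?thesis unfolding visible_def by blast
qed

lemma dual_witness: "dual_mutual_visibility_set G W"
proof -
  interpret swap: three_corners n b a c using ab ac bc by unfold_locales auto
  note swap = swap.visible_corner_near swap.visible_corner_other_near
  have M: "visible G W u v" if "u \<in> W" "v \<in> W" "u \<noteq> v" for u v
  proof -
    have sym: "visible G W x y" if "visible G W y x" for x y
      using visible_sym[OF _ that] sym_gasket by simp
    have "x = corner_pt N a \<or> x = corner_pt N b \<or> x = near N a c \<or> x = near N b c" if "x \<in> W" for x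
      using that by (simp add: witness_def)
    from this[OF \<open>u \<in> W\<close>] this[OF \<open>v \<in> W\<close>] \<open>u \<noteq> v\<close> show ?thesis
      using visible_corner_near visible_corners visible_corner_other_near visible_nears
        swap[unfolded witness_commute[of N b a c]]
      by (elim disjE; hypsubst; blast intro: sym)
  qed
  moreover have "W \<subseteq> pverts (gasket N)"
    using corner_pt_vert near_vert by (auto simp: witness_def)
  ultimately show ?thesis
    unfolding dual_mutual_visibility_set_def using visible_complement by simp
qed

lemma card_witness: "card W = 4"
proof -
  have "near N a c \<noteq> near N b c"
  proof
    assume "near N a c = near N b c"
    moreover have "near N a c b = 0" "near N b c b = 2 ^ N - 1"
      using ab bc by (simp_all add: near_def delta_def)
    ultimately have "2 ^ N - 1 = (0::nat)" by metis
    with two_power show False by linarith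
  qed
  moreover have "corner_pt N e \<noteq> near N d c" if "d \<noteq> c" for d e
    using near_ne_corner_pt[of N c d e] that by simp
  ultimately show ?thesis
    unfolding witness_def using ab ac bc by (auto simp: card_insert_if corner_pt_eq_iff)
qed

end

theorem theorem5:
  fixes n :: nat
  assumes "n \<ge> 1"
  shows "(n = 1 \<longrightarrow> mu_d (with_proj (ST n)) = 3) \<and> (n \<ge> 2 \<longrightarrow> mu_d (with_proj (ST n)) = 4)"
proof (intro conjI impI)
  assume n: "n = 1"
  have "mu_d (with_proj (gasket (Suc 0))) = 3"
  proof (rule mu_d_eqI[OF corner_pts_dual])
    have "inj (corner_pt (Suc 0))" by (simp add: inj_def corner_pt_eq_iff)
    then show "card (range (corner_pt (Suc 0))) = 3" by (simp add: card_image UNIV_corner)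
    show "card M \<le> 3" if "dual_mutual_visibility_set (with_proj (gasket (Suc 0))) M" for M
    proof -
      interpret dual_set 0 M using that by unfold_locales
      show ?thesis by (rule card_le_3) simp
    qed
  qed
  then show "mu_d (with_proj (ST n)) = 3" by (simp only: mu_d_ST n One_nat_def)
next
  assume "n \<ge> 2"
  then obtain m where m: "n = Suc (Suc m)" by (metis Suc_le_D numeral_2_eq_2 Suc_le_mono)
  have W: "three_corners TopC LeftC RightC" by unfold_locales auto
  have "mu_d (with_proj (gasket (Suc (Suc m)))) = 4"
  proof (rule mu_d_eqI[OF three_corners.dual_witness[OF W] three_corners.card_witness[OF W]])
    show "card M \<le> 4" if "dual_mutual_visibility_set (with_proj (gasket (Suc (Suc m)))) M" for M
    proof -
      interpret dual_set "Suc m" M using that by unfold_locales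
      show ?thesis by (rule card_le_4)
    qed
  qed
  then show "mu_d (with_proj (ST n)) = 4" by (simp only: mu_d_ST m)
qed

end
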